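(* Let $a,p,n,M$ be fixed. There exist $\hat s_0=\hat s_0(a,p,n,M)\ge s_0$ and $\hat\theta_0=\hat\theta_0(a,p,n,M)$ such that the following holds. Let $w$ be a solution, on $\mathbb{R}^n\times[-\log T,+\infty)$, of $$\partial_s w=\frac1\rho\,\mathrm{div}(\rho\nabla w)-\frac{w}{p-1}+|w|^{p-1}w+e^{-\frac{ps}{p-1}}h\left(e^{\frac{s}{p-1}}w\right)$$ such that $w,w_s,\nabla w,\nabla^2w$ are bounded and continuous on $\mathbb{R}^n\times[-\log T,S]$ for all $S<+\infty$. If $\theta\ge\hat\theta_0$, then for all $s_2>s_1\ge\max\{\hat s_0,-\log T\}$, $$\mathcal J[w](s_2)-\mathcal J[w](s_1)\le-\frac12\int_{s_1}^{s_2}\int_{\mathbb{R}^n}(\partial_sw)^2\rho\,dy\,ds,$$ where $\mathcal J[w](s)=\mathcal E[w](s)\,e^{\frac{\gamma}{a-1}s^{1-a}}+\theta s^{1-a}$.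
   Context: Standing setting: $n\ge1$, $a>1$, $M>0$, $p>1$ with $(n-2)p<n+2$, $T>0$. The function $h\in\mathcal C^1(\mathbb{R},\mathbb{R})$ satisfies $|h^{(j)}(z)|\le M\left(\frac{|z|^{p-j}}{\log^a(2+z^2)}+1\right)$ for $j=0,1$ and $|h''(z)|\le M\frac{|z|^{p-2}}{\log^a(2+z^2)}$ (for $z\neq0$, where $h$ is twice differentiable). The weight is $\rho(y)=(4\pi)^{-n/2}e^{-|y|^2/4}$. The constants $C_0>0$, $s_0>0$ (depending only on $a,p,M$) are fixed such that $e^{-\frac{(p-j)s}{p-1}}\left|h^{(j)}\left(e^{\frac{s}{p-1}}z\right)\right|\le\frac{C_0}{s^a}(|z|^{p-j}+1)$ for all $z\in\mathbb{R}$, $s\ge s_0$, $j=0,1$; such constants exist. Set $\gamma=8C_0\left(\frac{p+1}{p-1}\right)^2$, $H(z)=\int_0^zh(\xi)d\xi$, and $$\mathcal E[w](s)=\int_{\mathbb{R}^n}\left(\frac12|\nabla w|^2+\frac1{2(p-1)}|w|^2-\frac1{p+1}|w|^{p+1}\right)\rho\,dy-e^{-\frac{p+1}{p-1}s}\int_{\mathbb{R}^n}H\left(e^{\frac{s}{p-1}}w\right)\rho\,dy.$$ *)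

theory Defs
  imports "HOL-Analysis.Analysis"
begin

section \<open>Differential operators on \<open>\<real>\<^sup>n\<close>\<close>

definition grad :: "(real ^ 'n::finite \<Rightarrow> real) \<Rightarrow> real ^ 'n \<Rightarrow> real ^ 'n" where
  "grad f y = (THE D. GDERIV f y :> D)"

definition divergence :: "(real ^ 'n::finite \<Rightarrow> real ^ 'n) \<Rightarrow> real ^ 'n \<Rightarrow> real" where
  "divergence F y = trace (jacobian F (at y))"

definition hessian :: "(real ^ 'n::finite \<Rightarrow> real) \<Rightarrow> real ^ 'n \<Rightarrow> real ^ 'n ^ 'n" where
  "hessian f y = jacobian (grad f) (at y)"

text \<open>Functions of space and time are curried, \<open>w y s\<close>, and are only relevant for \<open>s \<ge> t\<close>,
  where \<open>t\<close> is the initial time; at \<open>s = t\<close> the time derivative is one-sided.\<close>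

definition time_deriv :: "real \<Rightarrow> ('b \<Rightarrow> real \<Rightarrow> real) \<Rightarrow> 'b \<Rightarrow> real \<Rightarrow> real" where
  "time_deriv t w y s = vector_derivative (w y) (at s within {t..})"


section \<open>The nonlinearity and the associated constants\<close>

definition nonlinearity :: "real \<Rightarrow> real \<Rightarrow> real \<Rightarrow> (real \<Rightarrow> real) \<Rightarrow> bool" where
  "nonlinearity a p M h \<longleftrightarrow>
     (\<forall>z. h differentiable (at z)) \<and> continuous_on UNIV (deriv h) \<and>
     (\<forall>j\<in>{0, 1::nat}. \<forall>z.
        \<bar>(deriv ^^ j) h z\<bar> \<le> M * (\<bar>z\<bar> powr (p - real j) / ln (2 + z\<^sup>2) powr a + 1)) \<and>
     (\<forall>z. z \<noteq> 0 \<longrightarrow> deriv h differentiable (at z) \<and>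
        \<bar>(deriv ^^ 2) h z\<bar> \<le> M * (\<bar>z\<bar> powr (p - 2) / ln (2 + z\<^sup>2) powr a))"

text \<open>The constants are uniform over all nonlinearities with the same \<open>a\<close>, \<open>p\<close>, \<open>M\<close>.\<close>

definition scaling_constants :: "real \<Rightarrow> real \<Rightarrow> real \<Rightarrow> real \<Rightarrow> real \<Rightarrow> bool" where
  "scaling_constants a p M C\<^sub>0 s\<^sub>0 \<longleftrightarrow> C\<^sub>0 > 0 \<and> s\<^sub>0 > 0 \<and>
     (\<forall>h. nonlinearity a p M h \<longrightarrow>
        (\<forall>z. \<forall>s\<ge>s\<^sub>0. \<forall>j\<in>{0, 1::nat}.
           exp (- ((p - real j) * s / (p - 1))) * \<bar>(deriv ^^ j) h (exp (s / (p - 1)) * z)\<bar>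
             \<le> C\<^sub>0 / s powr a * (\<bar>z\<bar> powr (p - real j) + 1)))"

lemma powr_times_exp_bounded:
  fixes a c s :: real
  assumes "a > 0" "c > 0" "s > 0"
  shows "exp (- (c * s)) \<le> (a / c) powr a / s powr a"
proof -
  have "(c * s / a) powr a \<le> exp (c * s / a) powr a"
  proof (rule powr_mono2)
    show "c * s / a \<le> exp (c * s / a)"
      using exp_ge_add_one_self[of "c * s / a"] by linarith
  qed (use assms in auto)
  also have "\<dots> = exp (c * s)"
    using assms by (simp add: powr_def)
  finally have "(c * s / a) powr a \<le> exp (c * s)" .
  moreover have "(c * s / a) powr a = s powr a / (a / c) powr a"
    using assms by (simp add: powr_divide powr_mult)
  moreover have "(a / c) powr a > 0" "s powr a > 0"
    using assms by auto
  ultimately show ?thesis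
    by (simp add: exp_minus field_simps)
qed

lemma scaled_bound:
  fixes a p M q :: real
  assumes a: "a > 1" and M: "M > 0" and p: "p > 1" and q: "q > 0"
  shows "\<exists>C>0. \<forall>s\<ge>1. \<forall>z x. \<bar>x\<bar> \<le> M * (\<bar>exp (s / (p - 1)) * z\<bar> powr q
            / ln (2 + (exp (s / (p - 1)) * z)\<^sup>2) powr a + 1) \<longrightarrow>
          exp (- (q * s / (p - 1))) * \<bar>x\<bar> \<le> C / s powr a * (\<bar>z\<bar> powr q + 1)"
proof -
  define c where "c = q / (2 * (p - 1))"
  have c: "c > 0" using p q by (simp add: c_def)
  define K where "K = (a / c) powr a"
  have K: "K > 0" using a c by (simp add: K_def)
  define L where "L = ln (2::real) powr a"
  have L: "L > 0" by (simp add: L_def)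
  define C where "C = M * ((p - 1) powr a + K / L + K)"
  have P: "(p - 1) powr a > 0" using p by auto
  have Cpos: "C > 0" using M K L P by (simp add: C_def add_pos_pos)
  show ?thesis
  proof (intro exI[of _ C] conjI Cpos allI impI)
    fix s z x :: real
    assume s: "1 \<le> s"
    define E where "E = exp (s / (p - 1))"
    define l where "l = ln (2 + (E * z)\<^sup>2)"
    assume "\<bar>x\<bar> \<le> M * (\<bar>exp (s / (p - 1)) * z\<bar> powr q
            / ln (2 + (exp (s / (p - 1)) * z)\<^sup>2) powr a + 1)"
    then have x: "\<bar>x\<bar> \<le> M * (\<bar>E * z\<bar> powr q / l powr a + 1)"
      by (simp add: E_def l_def)
    have E: "E > 0" by (simp add: E_def)
    have Eq: "E powr q = exp (q * s / (p - 1))"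
      by (simp add: E_def powr_def)
    have l2: "l \<ge> ln 2" unfolding l_def by (intro ln_mono) auto
    have lpos: "l > 0" using l2 ln_gt_zero[of 2] by linarith
    have lL: "l powr a \<ge> L" unfolding L_def
      using l2 a by (intro powr_mono2) auto
    have sa: "s powr a > 0" using s by auto
    have expc: "exp (- (c * s)) \<le> K / s powr a"
      unfolding K_def by (rule powr_times_exp_bounded) (use a c s in auto)
    have "exp (- (q * s / (p - 1))) * \<bar>x\<bar>
        \<le> exp (- (q * s / (p - 1))) * (M * (\<bar>E * z\<bar> powr q / l powr a + 1))"
      using x by simp
    also have "\<bar>E * z\<bar> powr q = exp (q * s / (p - 1)) * \<bar>z\<bar> powr q"
      using E by (simp add: abs_mult powr_mult Eq)
    also have "exp (- (q * s / (p - 1))) * (M * (exp (q * s / (p - 1)) * \<bar>z\<bar> powr q / l powr a + 1))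
        = M * (\<bar>z\<bar> powr q / l powr a + exp (- (q * s / (p - 1))))"
      by (simp add: exp_minus field_simps)
    also have "\<dots> \<le> C / s powr a * (\<bar>z\<bar> powr q + 1)"
    proof -
      have "exp (- (q * s / (p - 1))) \<le> exp (- (c * s))"
        using p q s by (simp add: c_def field_simps)
      then have B: "exp (- (q * s / (p - 1))) \<le> K / s powr a" using expc by linarith
      have A: "\<bar>z\<bar> powr q / l powr a \<le>
          ((p - 1) powr a * \<bar>z\<bar> powr q + K / L) / s powr a"
      proof (cases "\<bar>z\<bar> \<ge> exp (- (s / (2 * (p - 1))))")
        case True
        have "(exp (- (s / (2 * (p - 1)))))\<^sup>2 \<le> \<bar>z\<bar>\<^sup>2"
          using True by (intro power_mono) auto
        then have "E\<^sup>2 * (exp (- (s / (2 * (p - 1)))))\<^sup>2 \<le> (E * z)\<^sup>2"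
          by (simp add: power_mult_distrib mult_left_mono)
        moreover have "E\<^sup>2 * (exp (- (s / (2 * (p - 1)))))\<^sup>2 = exp (s / (p - 1))"
        proof -
          have "2 * (s / (p - 1)) + 2 * (- (s / (2 * (p - 1)))) = s / (p - 1)"
            by (simp only: divide_divide_eq_left[symmetric])
          then show ?thesis
            by (metis E_def exp_add exp_double)
        qed
        ultimately have "exp (s / (p - 1)) \<le> 2 + (E * z)\<^sup>2" by linarith
        then have "ln (exp (s / (p - 1))) \<le> l"
          unfolding l_def by (intro ln_mono) auto
        then have "s / (p - 1) \<le> l" by simp
        then have "(s / (p - 1)) powr a \<le> l powr a"
          using s p a by (intro powr_mono2) auto
        then have "s powr a / (p - 1) powr a \<le> l powr a"
          using s p by (simp add: powr_divide)
        then have "\<bar>z\<bar> powr q / l powr a \<le> \<bar>z\<bar> powr q / (s powr a / (p - 1) powr a)"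
          using sa P by (intro divide_left_mono mult_pos_pos) (use lpos in auto)
        also have "\<dots> = (p - 1) powr a * \<bar>z\<bar> powr q / s powr a"
          by simp
        also have "\<dots> \<le> ((p - 1) powr a * \<bar>z\<bar> powr q + K / L) / s powr a"
          using sa K L by (intro divide_right_mono) auto
        finally show ?thesis .
      next
        case False
        then have "\<bar>z\<bar> powr q \<le> exp (- (s / (2 * (p - 1)))) powr q"
          using q by (intro powr_mono2) auto
        also have "\<dots> = exp (- (c * s))"
          by (simp add: powr_def c_def)
        finally have "\<bar>z\<bar> powr q \<le> K / s powr a" using expc by linarith
        then have "\<bar>z\<bar> powr q / l powr a \<le> K / s powr a / L"
          using lL L K sa by (intro frac_le) auto
        also have "\<dots> \<le> ((p - 1) powr a * \<bar>z\<bar> powr q + K / L) / s powr a"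
          using sa P by (simp add: field_simps)
        finally show ?thesis .
      qed
      have "M * (\<bar>z\<bar> powr q / l powr a + exp (- (q * s / (p - 1))))
          \<le> M * (((p - 1) powr a * \<bar>z\<bar> powr q + K / L) / s powr a + K / s powr a)"
        using A B M by (intro mult_left_mono add_mono) auto
      also have "\<dots> = M * ((p - 1) powr a * \<bar>z\<bar> powr q + (K / L + K)) / s powr a"
        by (simp add: add_divide_distrib algebra_simps)
      also have "\<dots> \<le> M * (((p - 1) powr a + K / L + K) * (\<bar>z\<bar> powr q + 1)) / s powr a"
        using M K L P sa
        by (intro divide_right_mono mult_left_mono) (auto simp: algebra_simps)
      finally show ?thesis by (simp add: C_def mult.assoc)
    qed
    finally show "exp (- (q * s / (p - 1))) * \<bar>x\<bar> \<le> C / s powr a * (\<bar>z\<bar> powr q + 1)" .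
  qed
qed

lemma scaling_constants_exist:
  fixes a p M :: real
  assumes "a > 1" "M > 0" "p > 1"
  shows "\<exists>C\<^sub>0 s\<^sub>0. scaling_constants a p M C\<^sub>0 s\<^sub>0"
proof -
  define B where "B q C \<longleftrightarrow> (\<forall>s\<ge>1. \<forall>z x. \<bar>x\<bar> \<le> M * (\<bar>exp (s / (p - 1)) * z\<bar> powr q
            / ln (2 + (exp (s / (p - 1)) * z)\<^sup>2) powr a + 1) \<longrightarrow>
          exp (- (q * s / (p - 1))) * \<bar>x\<bar> \<le> C / s powr a * (\<bar>z\<bar> powr q + 1))" for q C
  obtain C0 where C0: "C0 > 0" "B p C0"
    using scaled_bound[of a M p p] assms unfolding B_def by auto
  obtain C1 where C1: "C1 > 0" "B (p - 1) C1"
    using scaled_bound[of a M p "p - 1"] assms unfolding B_def by auto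
  have mono: "B q C'" if "B q C" "C \<le> C'" for q C C'
    unfolding B_def
  proof (intro allI impI)
    fix s z x :: real
    assume s: "1 \<le> s" and x: "\<bar>x\<bar> \<le> M * (\<bar>exp (s / (p - 1)) * z\<bar> powr q
            / ln (2 + (exp (s / (p - 1)) * z)\<^sup>2) powr a + 1)"
    have "exp (- (q * s / (p - 1))) * \<bar>x\<bar> \<le> C / s powr a * (\<bar>z\<bar> powr q + 1)"
      using \<open>B q C\<close> s x unfolding B_def by blast
    also have "\<dots> \<le> C' / s powr a * (\<bar>z\<bar> powr q + 1)"
      using \<open>C \<le> C'\<close> by (intro mult_right_mono divide_right_mono) auto
    finally show "exp (- (q * s / (p - 1))) * \<bar>x\<bar> \<le> C' / s powr a * (\<bar>z\<bar> powr q + 1)" .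
  qed
  define C where "C = max C0 C1"
  have "B p C" "B (p - 1) C"
    using mono C0 C1 by (auto simp: C_def)
  then have B: "B (p - real j) C" if "j \<in> {0, 1}" for j
    using that by auto
  have "scaling_constants a p M C 1"
    unfolding scaling_constants_def
  proof (intro conjI allI impI ballI)
    show "C > 0" using C0 by (simp add: C_def)
  next
    fix h :: "real \<Rightarrow> real" and z s :: real and j :: nat
    assume h: "nonlinearity a p M h" and s: "1 \<le> s" and j: "j \<in> {0, 1}"
    have "\<bar>(deriv ^^ j) h y\<bar> \<le> M * (\<bar>y\<bar> powr (p - real j) / ln (2 + y\<^sup>2) powr a + 1)" for y
      using h j unfolding nonlinearity_def by blast
    then show "exp (- ((p - real j) * s / (p - 1))) * \<bar>(deriv ^^ j) h (exp (s / (p - 1)) * z)\<bar>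
             \<le> C / s powr a * (\<bar>z\<bar> powr (p - real j) + 1)"
      using B[OF j] s unfolding B_def by blast
  qed simp
  then show ?thesis by blast
qed


section \<open>The equation in similarity variables\<close>

definition gauss_weight :: "real ^ 'n::finite \<Rightarrow> real" where
  "gauss_weight y = (4 * pi) powr (- (real CARD('n) / 2)) * exp (- ((norm y)\<^sup>2 / 4))"

definition bounded_continuous_on ::
    "'b::topological_space set \<Rightarrow> ('b \<Rightarrow> 'c::metric_space) \<Rightarrow> bool" where
  "bounded_continuous_on Q F \<longleftrightarrow> continuous_on Q F \<and> bounded (F ` Q)"

text \<open>\<open>w\<close>, \<open>w\<^sub>s\<close>, \<open>\<nabla>w\<close> and \<open>\<nabla>\<^sup>2w\<close> exist on \<open>\<real>\<^sup>n \<times> [t, \<infinity>)\<close>, and are jointly continuous and bounded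
  on every slab \<open>\<real>\<^sup>n \<times> [t, S]\<close>.\<close>

definition regular_from :: "real \<Rightarrow> (real ^ 'n::finite \<Rightarrow> real \<Rightarrow> real) \<Rightarrow> bool" where
  "regular_from t w \<longleftrightarrow>
     (\<forall>y. \<forall>s\<ge>t. w y differentiable (at s within {t..}) \<and>
        (\<lambda>x. w x s) differentiable (at y) \<and>
        grad (\<lambda>x. w x s) differentiable (at y)) \<and>
     (\<forall>S. bounded_continuous_on (UNIV \<times> {t..S}) (\<lambda>(y, s). w y s) \<and>
          bounded_continuous_on (UNIV \<times> {t..S}) (\<lambda>(y, s). time_deriv t w y s) \<and>
          bounded_continuous_on (UNIV \<times> {t..S}) (\<lambda>(y, s). grad (\<lambda>x. w x s) y) \<and>
          bounded_continuous_on (UNIV \<times> {t..S}) (\<lambda>(y, s). hessian (\<lambda>x. w x s) y))"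

definition solution_from ::
    "real \<Rightarrow> real \<Rightarrow> (real \<Rightarrow> real) \<Rightarrow> (real ^ 'n::finite \<Rightarrow> real \<Rightarrow> real) \<Rightarrow> bool" where
  "solution_from t p h w \<longleftrightarrow> (\<forall>y. \<forall>s\<ge>t.
     time_deriv t w y s =
       1 / gauss_weight y * divergence (\<lambda>x. gauss_weight x *\<^sub>R grad (\<lambda>x'. w x' s) x) y
       - w y s / (p - 1) + \<bar>w y s\<bar> powr (p - 1) * w y s
       + exp (- (p * s / (p - 1))) * h (exp (s / (p - 1)) * w y s))"


section \<open>The energy and the Lyapunov functional\<close>

text \<open>The interval integral is oriented, so this is also the intended primitive for \<open>z < 0\<close>.\<close>

definition primitive :: "(real \<Rightarrow> real) \<Rightarrow> real \<Rightarrow> real" where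
  "primitive h z = (LBINT \<xi>=0..z. h \<xi>)"

definition energy ::
    "real \<Rightarrow> (real \<Rightarrow> real) \<Rightarrow> (real ^ 'n::finite \<Rightarrow> real \<Rightarrow> real) \<Rightarrow> real \<Rightarrow> real" where
  "energy p h w s =
     (\<integral>y. (1 / 2 * (norm (grad (\<lambda>x. w x s) y))\<^sup>2 + 1 / (2 * (p - 1)) * \<bar>w y s\<bar>\<^sup>2
           - 1 / (p + 1) * \<bar>w y s\<bar> powr (p + 1)) * gauss_weight y \<partial>lborel)
     - exp (- ((p + 1) / (p - 1) * s)) *
       (\<integral>y. primitive h (exp (s / (p - 1)) * w y s) * gauss_weight y \<partial>lborel)"

definition lyapunov_rate :: "real \<Rightarrow> real \<Rightarrow> real" where
  "lyapunov_rate p C\<^sub>0 = 8 * C\<^sub>0 * ((p + 1) / (p - 1))\<^sup>2"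

definition lyapunov ::
    "real \<Rightarrow> real \<Rightarrow> real \<Rightarrow> real \<Rightarrow> (real \<Rightarrow> real) \<Rightarrow> (real ^ 'n::finite \<Rightarrow> real \<Rightarrow> real) \<Rightarrow> real \<Rightarrow> real"
  where
  "lyapunov a p C\<^sub>0 \<theta> h w s =
     energy p h w s * exp (lyapunov_rate p C\<^sub>0 / (a - 1) * s powr (1 - a)) + \<theta> * s powr (1 - a)"

end

theory Submission
  imports Defs "HOL-Probability.Distributions"
begin

text \<open>
  Differentiating the energy gives \<open>\<E>' = - \<integral> w\<^sub>s\<^sup>2 \<rho> + R\<close>, where the remainder \<open>R\<close> comes from the explicit
  time dependence of the perturbation and is at most \<open>C\<^sub>0 s\<^sup>-\<^sup>a (K \<integral> |w|\<^sup>p\<^sup>+\<^sup>1 \<rho> + K')\<close>. Testing the equation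
  with \<open>w\<close> gives \<open>\<integral> w w\<^sub>s \<rho> = - 2 \<E> + (p - 1)/(p + 1) \<integral> |w|\<^sup>p\<^sup>+\<^sup>1 \<rho> + O(s\<^sup>-\<^sup>a)(1 + \<integral> |w|\<^sup>p\<^sup>+\<^sup>1 \<rho>)\<close>, which for
  large \<open>s\<close> bounds \<open>\<integral> |w|\<^sup>p\<^sup>+\<^sup>1 \<rho>\<close> by \<open>\<E>\<close>, the dissipation and a constant. Hence
  \<open>\<E>' - \<gamma> s\<^sup>-\<^sup>a \<E> \<le> - (1/2) \<integral> w\<^sub>s\<^sup>2 \<rho> + c s\<^sup>-\<^sup>a\<close>. The factor \<open>exp (\<gamma> s\<^sup>1\<^sup>-\<^sup>a / (a - 1))\<close> absorbs \<open>\<gamma> s\<^sup>-\<^sup>a \<E>\<close>, and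
  the term \<open>\<theta> s\<^sup>1\<^sup>-\<^sup>a\<close> absorbs \<open>c s\<^sup>-\<^sup>a\<close>.
\<close>

section \<open>Differentiation under the integral sign\<close>

text \<open>The rate \<open>lyapunov_rate\<close> comes from weighing the virial identity against
  the remainder. Write x = (p+1)/(p-1), k = \<open>C\<^sub>0\<close> s^(-a), E for the energy, W for
  the dissipation and P for the weighted integral of |w|^(p+1). Up to constants the remainder costs
  k (p+2)^2/((p-1)(p+1)) P, which is at most 3xk P. The virial identity carries P with coefficient
  1/x; a quarter of it pays for error terms, so 3/(4x) P is bounded by 2E + W plus a constant.
  Multiplied by 4x^2 k, this controls 3xk P, produces 8x^2 k E = \<gamma> s^(-a) E, and takes 4x^2 k
  W from the dissipation, at most W/2 once s is large. No sign of E is known, so \<gamma> s^(-a) E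
  cannot be estimated; an integrating factor removes it exactly. The analytic obstacle is the drift
  -(y/2).grad w: it grows linearly in y, so majorants have the form (1+|y|)\<rho>. Bounds on w over
  a slab justify limits and integrations by parts but enter no constant, which is why the thresholds
  are uniform in w.\<close>

lemma dominated_convergence_within:
  fixes f :: "'a::first_countable_topology \<Rightarrow> 'b \<Rightarrow> real"
  assumes "\<And>s. s \<in> S \<Longrightarrow> f s \<in> borel_measurable M"
    and "g \<in> borel_measurable M"
    and lim: "\<And>y. ((\<lambda>s. f s y) \<longlongrightarrow> g y) (at s\<^sub>0 within S)"
    and bound: "\<And>s y. s \<in> S \<Longrightarrow> s \<noteq> s\<^sub>0 \<Longrightarrow> \<bar>f s y\<bar> \<le> G y"
    and "integrable M G"
  shows "((\<lambda>s. \<integral>y. f s y \<partial>M) \<longlongrightarrow> (\<integral>y. g y \<partial>M)) (at s\<^sub>0 within S)"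
  unfolding tendsto_at_iff_sequentially o_def
proof (intro allI impI)
  fix X :: "nat \<Rightarrow> 'a"
  assume X: "\<forall>i. X i \<in> S - {s\<^sub>0}" "X \<longlonglongrightarrow> s\<^sub>0"
  show "(\<lambda>i. \<integral>y. f (X i) y \<partial>M) \<longlonglongrightarrow> (\<integral>y. g y \<partial>M)"
  proof (rule integral_dominated_convergence[where w = G])
    show "AE y in M. (\<lambda>i. f (X i) y) \<longlonglongrightarrow> g y"
      using lim X unfolding tendsto_at_iff_sequentially o_def by blast
  qed (use assms X in auto)
qed

text \<open>On the convex set \<open>S\<close> the mean value inequality bounds every difference
  quotient by \<open>G\<close>, so dominated convergence applies. Working within \<open>S\<close>
  covers the end points of a time interval.\<close>

lemma has_real_derivative_integral:
  fixes f f' :: "real \<Rightarrow> 'b \<Rightarrow> real"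
  assumes "convex S" "s\<^sub>0 \<in> S"
    and int: "\<And>s. s \<in> S \<Longrightarrow> integrable M (f s)"
    and meas: "f' s\<^sub>0 \<in> borel_measurable M"
    and der: "\<And>s y. s \<in> S \<Longrightarrow> ((\<lambda>s. f s y) has_real_derivative f' s y) (at s within S)"
    and bound: "\<And>s y. s \<in> S \<Longrightarrow> \<bar>f' s y\<bar> \<le> G y"
    and "integrable M G"
  shows "((\<lambda>s. \<integral>y. f s y \<partial>M) has_real_derivative (\<integral>y. f' s\<^sub>0 y \<partial>M)) (at s\<^sub>0 within S)"
proof -
  have "((\<lambda>s. \<integral>y. (f s y - f s\<^sub>0 y) / (s - s\<^sub>0) \<partial>M) \<longlongrightarrow> (\<integral>y. f' s\<^sub>0 y \<partial>M)) (at s\<^sub>0 within S)"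
  proof (rule dominated_convergence_within[where G = G])
    show "((\<lambda>s. (f s y - f s\<^sub>0 y) / (s - s\<^sub>0)) \<longlongrightarrow> f' s\<^sub>0 y) (at s\<^sub>0 within S)" for y
      using der[OF \<open>s\<^sub>0 \<in> S\<close>] unfolding has_field_derivative_iff .
    show "\<bar>(f s y - f s\<^sub>0 y) / (s - s\<^sub>0)\<bar> \<le> G y" if "s \<in> S" "s \<noteq> s\<^sub>0" for s y
    proof -
      have "norm (f s y - f s\<^sub>0 y) \<le> G y * norm (s - s\<^sub>0)"
        using der bound that \<open>s\<^sub>0 \<in> S\<close> \<open>convex S\<close>
        by (intro field_differentiable_bound[of S "\<lambda>s. f s y" "\<lambda>s. f' s y"]) auto
      then show ?thesis
        using that by (simp add: abs_divide divide_le_eq)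
    qed
    show "(\<lambda>y. (f s y - f s\<^sub>0 y) / (s - s\<^sub>0)) \<in> borel_measurable M" if "s \<in> S" for s
      using int[OF that, THEN borel_measurable_integrable]
        int[OF \<open>s\<^sub>0 \<in> S\<close>, THEN borel_measurable_integrable] by measurable
  qed (use assms in auto)
  moreover have "\<forall>\<^sub>F s in at s\<^sub>0 within S. (\<integral>y. (f s y - f s\<^sub>0 y) / (s - s\<^sub>0) \<partial>M)
      = ((\<integral>y. f s y \<partial>M) - (\<integral>y. f s\<^sub>0 y \<partial>M)) / (s - s\<^sub>0)"
    unfolding eventually_at_filter using int \<open>s\<^sub>0 \<in> S\<close>
    by (intro always_eventually allI impI)
       (simp add: Bochner_Integration.integral_diff)
  ultimately show ?thesis
    unfolding has_field_derivative_iff by (rule Lim_transform_eventually)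
qed

lemma borel_measurable_lborel_continuousI:
  "continuous_on UNIV f \<Longrightarrow> f \<in> borel_measurable lborel"
  by (simp add: borel_measurable_continuous_onI)

lemma integral_translate:
  fixes f :: "'a::euclidean_space \<Rightarrow> real"
  assumes "integrable lborel f"
  shows "integrable lborel (\<lambda>y. f (y + v))" "(\<integral>y. f (y + v) \<partial>lborel) = (\<integral>y. f y \<partial>lborel)"
proof -
  have eq: "lborel = distr lborel borel (\<lambda>x. v + x :: 'a)"
    using lborel_distr_plus[of v] by simp
  have "integrable (distr lborel borel (\<lambda>x. v + x)) f"
    using assms eq by simp
  then show "integrable lborel (\<lambda>y. f (y + v))"
    using borel_measurable_integrable[OF assms] by (subst (asm) integrable_distr_eq) (auto simp: add.commute)
  show "(\<integral>y. f (y + v) \<partial>lborel) = (\<integral>y. f y \<partial>lborel)"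
    using borel_measurable_integrable[OF assms]
    by (subst (2) eq, subst integral_distr) (auto simp: add.commute)
qed

text \<open>By translation invariance \<open>\<integral> f (y + \<tau> v) dy\<close> does not depend on \<open>\<tau>\<close>; differentiate in \<open>\<tau>\<close>.\<close>

lemma integral_directional_derivative_eq_0:
  fixes f :: "'a::euclidean_space \<Rightarrow> real" and v :: 'a
  assumes der: "\<And>y. (f has_derivative f' y) (at y)"
    and int: "integrable lborel f"
    and meas: "(\<lambda>y. f' y v) \<in> borel_measurable borel"
    and bound: "\<And>\<tau> y. \<bar>\<tau>\<bar> \<le> 1 \<Longrightarrow> \<bar>f' (y + \<tau> *\<^sub>R v) v\<bar> \<le> G y"
    and G: "integrable lborel G"
  shows "(\<integral>y. f' y v \<partial>lborel) = 0"
proof -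
  \<comment> \<open>Only shifts with |\<tau>| at most 1 need a common majorant: the interval is
    convex and has 0 in its interior, so the derivative at 0 is unaffected by the
    restriction.\<close>
  have "((\<lambda>\<tau>. \<integral>y. f (y + \<tau> *\<^sub>R v) \<partial>lborel) has_real_derivative (\<integral>y. f' (y + 0 *\<^sub>R v) v \<partial>lborel))
      (at 0 within {-1..1})"
  proof (rule has_real_derivative_integral[where G = G])
    fix \<tau> :: real and y :: 'a
    have "((\<lambda>\<tau>. f (y + \<tau> *\<^sub>R v)) has_derivative (\<lambda>x. f' (y + \<tau> *\<^sub>R v) (x *\<^sub>R v))) (at \<tau>)"
      by (rule has_derivative_compose[OF _ der, where f="\<lambda>\<tau>. y + \<tau> *\<^sub>R v"])
         (auto intro!: derivative_eq_intros)
    then have "((\<lambda>\<tau>. f (y + \<tau> *\<^sub>R v)) has_real_derivative f' (y + \<tau> *\<^sub>R v) v) (at \<tau>)"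
      using linear_scale[OF has_derivative_linear[OF der]]
      by (simp add: has_field_derivative_def mult.commute[of "f' _ _"])
         (simp add: mult_commute_abs)
    then show "((\<lambda>\<tau>. f (y + \<tau> *\<^sub>R v)) has_real_derivative f' (y + \<tau> *\<^sub>R v) v) (at \<tau> within {-1..1})"
      by (rule has_field_derivative_at_within)
  qed (use bound G meas integral_translate(1)[OF int] in auto)
  then have "((\<lambda>\<tau>::real. \<integral>y. f y \<partial>lborel) has_real_derivative (\<integral>y. f' y v \<partial>lborel)) (at 0)"
    using integral_translate(2)[OF int]
    by (simp add: at_within_interior[of "0::real" "{-1..1}"])
  then show ?thesis
    using DERIV_unique DERIV_const by blast
qed

section \<open>The Gaussian weight\<close>

text \<open>Lebesgue measure is the image of the product of one-dimensional Lebesgue measures over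
  \<open>Basis\<close>, and the Gaussian factors over the coordinates. Each factor is a multiple of
  the normal density of variance 1/(2c).\<close>

lemma integrable_gaussian:
  assumes "c > 0"
  shows "integrable lborel (\<lambda>y::'a::euclidean_space. exp (- c * (norm y)\<^sup>2))"
proof -
  interpret product_sigma_finite "\<lambda>b::'a. lborel :: real measure"
    by standard
  define \<sigma> where "\<sigma> = sqrt (1 / (2 * c))"
  have \<sigma>: "\<sigma> > 0" "\<sigma>\<^sup>2 = 1 / (2 * c)"
    using assms by (simp_all add: \<sigma>_def)
  have one: "integrable lborel (\<lambda>x::real. exp (- c * x\<^sup>2))"
  proof -
    have "integrable lborel (\<lambda>x. sqrt (2 * pi * \<sigma>\<^sup>2) * normal_density 0 \<sigma> x)"
      by (intro integrable_mult_right integrable_normal_density \<sigma>)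
    moreover have "sqrt (2 * pi * \<sigma>\<^sup>2) * normal_density 0 \<sigma> x = exp (- c * x\<^sup>2)" for x
      using assms \<sigma> by (simp add: normal_density_def)
    ultimately show ?thesis by simp
  qed
  have prod: "integrable (\<Pi>\<^sub>M b\<in>(Basis::'a set). lborel) (\<lambda>x. \<Prod>b\<in>Basis. exp (- c * (x b)\<^sup>2))"
    using one by (intro product_integrable_prod) auto
  have "integrable (\<Pi>\<^sub>M b\<in>(Basis::'a set). lborel)
      (\<lambda>x. exp (- c * (norm (\<Sum>b\<in>Basis. x b *\<^sub>R b :: 'a))\<^sup>2))"
  proof -
    have "(norm (\<Sum>b\<in>Basis. x b *\<^sub>R b :: 'a))\<^sup>2 = (\<Sum>b\<in>Basis. (x b)\<^sup>2)" for x
      unfolding power2_norm_eq_inner by (subst euclidean_inner) (simp add: power2_eq_square)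
    then show ?thesis
      using prod by (simp add: exp_sum sum_distrib_left)
  qed
  then show ?thesis
    by (subst lborel_eq, subst integrable_distr_eq) auto
qed

lemma gauss_weight_pos: "gauss_weight y > 0"
  by (simp add: gauss_weight_def)

lemma gauss_weight_nonneg [simp]: "0 \<le> gauss_weight y"
  by (rule less_imp_le[OF gauss_weight_pos])

lemma continuous_on_gauss_weight [continuous_intros]:
  "continuous_on A f \<Longrightarrow> continuous_on A (\<lambda>x. gauss_weight (f x))"
  unfolding gauss_weight_def by (intro continuous_intros) auto

lemma borel_measurable_gauss_weight [measurable]: "gauss_weight \<in> borel_measurable borel"
  by (intro borel_measurable_continuous_onI continuous_intros)

lemma has_derivative_gauss_weight:
  "(gauss_weight has_derivative (\<lambda>v. - (1/2) * (y \<bullet> v) * gauss_weight y)) (at y)"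
proof -
  have "((\<lambda>y. exp (- ((y \<bullet> y) / 4))) has_derivative (\<lambda>v. exp (- ((y \<bullet> y) / 4)) * (- (2 * (y \<bullet> v)) / 4))) (at y)"
    by (auto intro!: derivative_eq_intros simp: inner_commute field_simps)
  from has_derivative_mult_right[OF this, of "(4 * pi) powr (- (real CARD('a) / 2))"]
  show ?thesis
    unfolding gauss_weight_def power2_norm_eq_inner by (simp add: algebra_simps)
qed

text \<open>This is the majorant, uniform in the shift, that the translation argument behind
  integration by parts requires. Half of the exponent r^2/4 absorbs the linear factor 1 + r; the
  other half survives the shift because |y|^2 is at most 2r^2 + 2.\<close>

lemma gauss_weight_shift_bound:
  fixes y v :: "real ^ 'n::finite"
  assumes "norm v \<le> 1"
  shows "(1 + norm (y + v)) * gauss_weight (y + v)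
    \<le> (4 * pi) powr (- (real CARD('n) / 2)) * (3 * exp (1/8)) * exp (- (1/16) * (norm y)\<^sup>2)"
proof -
  define r where "r = norm (y + v)"
  have "norm y \<le> r + 1"
    using norm_triangle_ineq4[of "y + v" v] assms by (simp add: r_def)
  then have "(norm y)\<^sup>2 \<le> (r + 1)\<^sup>2"
    by (intro power_mono) auto
  also have "\<dots> \<le> 2 * r\<^sup>2 + 2"
    using zero_le_power2[of "r - 1"] by (simp add: power2_eq_square algebra_simps)
  finally have 1: "- (r\<^sup>2 / 8) \<le> 1/8 - (1/16) * (norm y)\<^sup>2"
    by simp
  have "1 + r \<le> 3 * (1 + r\<^sup>2 / 8)"
    using zero_le_power2[of "3 * r / 2 - 2"] by (simp add: power2_eq_square algebra_simps) 
  also have "\<dots> \<le> 3 * exp (r\<^sup>2 / 8)"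
    by (rule mult_left_mono[OF exp_ge_add_one_self]) simp
  finally have "(1 + r) * exp (- (r\<^sup>2 / 4)) \<le> 3 * exp (r\<^sup>2 / 8) * exp (- (r\<^sup>2 / 4))"
    by (intro mult_right_mono) auto
  also have "\<dots> = 3 * exp (- (r\<^sup>2 / 8))"
    by (simp add: exp_add[symmetric])
  also have "\<dots> \<le> 3 * exp (1/8 - (1/16) * (norm y)\<^sup>2)"
    using 1 by simp
  also have "\<dots> = 3 * exp (1/8) * exp (- (1/16) * (norm y)\<^sup>2)"
    by (simp add: exp_add[symmetric])
  finally have "(1 + r) * exp (- (r\<^sup>2 / 4)) \<le> 3 * exp (1/8) * exp (- (1/16) * (norm y)\<^sup>2)" .
  from mult_left_mono[OF this, of "(4 * pi) powr (- (real CARD('n) / 2))"]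
  show ?thesis
    by (simp add: gauss_weight_def r_def mult_ac)
qed

lemma integrable_linear_growth_gauss_weight:
  "integrable lborel (\<lambda>y::real^'n::finite. (C * (1 + norm y)) * gauss_weight y)"
proof -
  have "integrable lborel (\<lambda>y::real^'n. (1 + norm y) * gauss_weight y)"
  proof (rule Bochner_Integration.integrable_bound)
    show "integrable lborel (\<lambda>y::real^'n. (4 * pi) powr (- (real CARD('n) / 2)) * (3 * exp (1/8)) * exp (- (1/16) * (norm y)\<^sup>2))"
      by (intro integrable_mult_right integrable_gaussian) auto
    show "AE y in lborel. norm ((1 + norm y) * gauss_weight (y::real^'n))
        \<le> norm ((4 * pi) powr (- (real CARD('n) / 2)) * (3 * exp (1/8)) * exp (- (1/16) * (norm y)\<^sup>2))"
    proof (rule AE_I2)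
      fix y :: "real^'n"
      show "norm ((1 + norm y) * gauss_weight y)
        \<le> norm ((4 * pi) powr (- (real CARD('n) / 2)) * (3 * exp (1/8)) * exp (- (1/16) * (norm y)\<^sup>2))"
        \<comment> \<open>This is the case of zero shift: the first instantiated variable is
          \<open>v\<close>.\<close>
        using gauss_weight_shift_bound[of 0 y] gauss_weight_pos[of y] by (simp add: abs_mult)
    qed
  qed simp
  from integrable_mult_right[OF this, of C] show ?thesis
    by (simp add: mult_ac)
qed

lemma integrable_gauss_weightI:
  fixes f :: "real^'n::finite \<Rightarrow> real"
  assumes [measurable]: "f \<in> borel_measurable borel" and "\<And>y. \<bar>f y\<bar> \<le> C * (1 + norm y)"
  shows "integrable lborel (\<lambda>y. f y * gauss_weight y)"
  by (rule Bochner_Integration.integrable_bound[OF integrable_linear_growth_gauss_weight[of C]])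
     (use assms gauss_weight_pos in \<open>auto simp: abs_mult less_imp_le intro!: AE_I2 mult_right_mono order_trans[OF assms(2)]\<close>)

lemma integrable_gauss_weight_boundedI:
  fixes f :: "real^'n::finite \<Rightarrow> real"
  assumes "f \<in> borel_measurable borel" and "\<And>y. \<bar>f y\<bar> \<le> C"
  shows "integrable lborel (\<lambda>y. f y * gauss_weight y)"
proof (rule integrable_gauss_weightI[where C = C])
  fix y :: "real^'n"
  have "C \<ge> 0" using assms(2)[of 0] by linarith
  then have "C * 1 \<le> C * (1 + norm y)"
    by (intro mult_left_mono) auto
  then show "\<bar>f y\<bar> \<le> C * (1 + norm y)"
    using assms(2)[of y] by linarith
qed (rule assms(1))

section \<open>Integration by parts\<close>

text \<open>\<open>drift_div y V\<^sub>y DV\<^sub>y\<close> is \<open>(1/\<rho>) div (\<rho> V)\<close> at \<open>y\<close>, where \<open>DV\<^sub>y\<close> is the Jacobian of \<open>V\<close>.\<close>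

definition drift_div :: "real^'n::finite \<Rightarrow> real^'n \<Rightarrow> real^'n^'n \<Rightarrow> real" where
  "drift_div y V A = trace A - 1/2 * (y \<bullet> V)"

lemma drift_div_add: "drift_div y (V + W) (A + C) = drift_div y V A + drift_div y W C"
  by (simp add: drift_div_def trace_def sum.distrib inner_add_right algebra_simps)

text \<open>For each coordinate the partial derivative of \<phi> V_i \<rho> has integral zero;
  summing over i gives the identity. One constant \<open>B\<close> bounds all data, so the
  integrands grow at most linearly apart from the weight.\<close>

lemma gauss_integration_by_parts:
  fixes \<phi> :: "real^'n::finite \<Rightarrow> real" and V :: "real^'n \<Rightarrow> real^'n"
  assumes d\<phi>: "\<And>y. GDERIV \<phi> y :> g\<phi> y"
    and dV: "\<And>y. (V has_derivative (\<lambda>v. A y *v v)) (at y)"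
    and c: "continuous_on UNIV g\<phi>" "continuous_on UNIV A"
    and b\<phi>: "\<And>y. \<bar>\<phi> y\<bar> \<le> B" "\<And>y. norm (g\<phi> y) \<le> B"
    and bV: "\<And>y. norm (V y) \<le> B" "\<And>y. norm (A y) \<le> B"
  shows "(\<integral>y. \<phi> y * drift_div y (V y) (A y) * gauss_weight y \<partial>lborel)
       = - (\<integral>y. (g\<phi> y \<bullet> V y) * gauss_weight y \<partial>lborel)"
proof -
  have c\<phi>: "continuous_on UNIV \<phi>"
    using d\<phi> unfolding gderiv_def by (intro has_derivative_continuous_on) auto
  have cV: "continuous_on UNIV V"
    using dV by (intro has_derivative_continuous_on) auto
  have B: "B \<ge> 0" using b\<phi>(1)[of 0] by linarith
  \<comment> \<open>\<open>F i\<close> is the i-th partial derivative of \<phi> V_i \<rho> divided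
    by \<rho>. Its last term comes from differentiating the Gaussian and is the only one that can
    grow with y.\<close>
  define F where "F i y = g\<phi> y $ i * V y $ i + \<phi> y * A y $ i $ i - 1/2 * (\<phi> y * (y $ i * V y $ i))" for i y
  have cF: "continuous_on UNIV (F i)" for i
    unfolding F_def by (intro continuous_intros c c\<phi> cV)
  have Vi: "\<bar>V y $ i\<bar> \<le> B" for y i
    using component_le_norm_cart[of "V y" i] bV(1)[of y] by linarith
  have Ai: "\<bar>A y $ i $ i\<bar> \<le> B" for y i
    using Finite_Cartesian_Product.norm_nth_le[of "A y" i] component_le_norm_cart[of "A y $ i" i] bV(2)[of y] by linarith
  have gi: "\<bar>g\<phi> y $ i\<bar> \<le> B" for y i
    using component_le_norm_cart[of "g\<phi> y" i] b\<phi>(2)[of y] by linarith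
  have bF: "\<bar>F i y\<bar> \<le> 2 * B\<^sup>2 * (1 + norm y)" for i y
  proof -
    have "\<bar>g\<phi> y $ i * V y $ i\<bar> \<le> B * B" "\<bar>\<phi> y * A y $ i $ i\<bar> \<le> B * B"
      unfolding abs_mult using Vi gi Ai b\<phi> B by (auto intro!: mult_mono)
    moreover have "\<bar>\<phi> y * (y $ i * V y $ i)\<bar> \<le> B * (norm y * B)"
      unfolding abs_mult using Vi b\<phi> B component_le_norm_cart[of y i] by (auto intro!: mult_mono)
    moreover have "B * (norm y * B) \<ge> 0" using B by simp
    ultimately show ?thesis unfolding F_def by (simp add: power2_eq_square algebra_simps)
  qed
  have intF: "integrable lborel (\<lambda>y. F i y * gauss_weight y)" for i
    by (rule integrable_gauss_weightI[OF _ bF]) (intro borel_measurable_continuous_onI cF)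
  have zero: "(\<integral>y. F i y * gauss_weight y \<partial>lborel) = 0" for i
  proof -
    define f where "f y = \<phi> y * V y $ i * gauss_weight y" for y
    define f' where "f' y v = (\<phi> y * V y $ i) * (- (1/2) * (y \<bullet> v) * gauss_weight y)
       + (\<phi> y * (A y *v v) $ i + (v \<bullet> g\<phi> y) * V y $ i) * gauss_weight y" for y v
    have f': "f' y (axis i 1) = F i y * gauss_weight y" for y
      by (simp add: f'_def F_def inner_axis inner_axis' algebra_simps matrix_vector_mult_basis column_def)
    have "(\<integral>y. f' y (axis i 1) \<partial>lborel) = 0"
    proof (rule integral_directional_derivative_eq_0)
      show "(f has_derivative f' y) (at y)" for y
        unfolding f_def f'_def
        by (rule has_derivative_mult has_derivative_gauss_weight
              d\<phi>[unfolded gderiv_def] bounded_linear.has_derivative[OF bounded_linear_vec_nth dV])+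
      show "integrable lborel f"
        unfolding f_def
      proof (rule integrable_gauss_weight_boundedI)
        show "\<bar>\<phi> y * V y $ i\<bar> \<le> B * B" for y
          unfolding abs_mult using Vi b\<phi> B by (auto intro!: mult_mono)
      qed (intro borel_measurable_continuous_onI continuous_intros c\<phi> cV)
      show "(\<lambda>y. f' y (axis i 1)) \<in> borel_measurable borel"
        unfolding f' by (intro borel_measurable_continuous_onI continuous_intros cF)
      \<comment> \<open>The factor \<open>2 * B\<^sup>2\<close> comes from \<open>bF\<close>, the
        rest from \<open>gauss_weight_shift_bound\<close>.\<close>
      define K where "K = 2 * B\<^sup>2 * ((4 * pi) powr (- (real CARD('n) / 2)) * (3 * exp (1/8)))"
      show "integrable lborel (\<lambda>y::real^'n. K * exp (- (1/16) * (norm y)\<^sup>2))"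
        by (intro integrable_mult_right integrable_gaussian) auto
      fix \<tau> :: real and y :: "real^'n"
      assume \<tau>: "\<bar>\<tau>\<bar> \<le> 1"
      define z where "z = y + \<tau> *\<^sub>R axis i 1"
      have "\<bar>f' z (axis i 1)\<bar> = \<bar>F i z\<bar> * gauss_weight z"
        using gauss_weight_pos[of z] by (simp add: f' abs_mult)
      also have "\<dots> \<le> 2 * B\<^sup>2 * (1 + norm z) * gauss_weight z"
        using gauss_weight_pos[of z] bF[of i z] by (intro mult_right_mono) auto
      also have "\<dots> \<le> K * exp (- (1/16) * (norm y)\<^sup>2)"
        using mult_left_mono[OF gauss_weight_shift_bound[of "\<tau> *\<^sub>R axis i 1" y], of "2 * B\<^sup>2"] \<tau>
        by (simp add: z_def K_def mult_ac)
      finally show "\<bar>f' (y + \<tau> *\<^sub>R axis i 1) (axis i 1)\<bar> \<le> K * exp (- (1/16) * (norm y)\<^sup>2)"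
        unfolding z_def .
    qed
    then show ?thesis unfolding f' .
  qed
  have "\<phi> y * drift_div y (V y) (A y) = (\<Sum>i\<in>UNIV. F i y) - g\<phi> y \<bullet> V y" for y
  proof -
    have "(\<Sum>i\<in>UNIV. F i y)
        = g\<phi> y \<bullet> V y + \<phi> y * trace (A y) - 1/2 * (\<phi> y * (y \<bullet> V y))"
      by (simp only: F_def sum.distrib sum_subtractf sum_distrib_left[symmetric] inner_vec_def trace_def inner_real_def)
    then show ?thesis
      by (simp add: drift_div_def algebra_simps)
  qed
  then have "\<phi> y * drift_div y (V y) (A y) * gauss_weight y
      = (\<Sum>i\<in>UNIV. F i y * gauss_weight y) - (g\<phi> y \<bullet> V y) * gauss_weight y" for y
    by (simp add: left_diff_distrib sum_distrib_right)
  moreover have "integrable lborel (\<lambda>y. (g\<phi> y \<bullet> V y) * gauss_weight y)"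
  proof (rule integrable_gauss_weight_boundedI)
    show "\<bar>g\<phi> y \<bullet> V y\<bar> \<le> B * B" for y
      using Cauchy_Schwarz_ineq2[of "g\<phi> y" "V y"] mult_mono[OF b\<phi>(2)[of y] bV(1)[of y]] B by auto
  qed (intro borel_measurable_continuous_onI continuous_intros c cV)
  ultimately show ?thesis
    using zero by (simp add: intF Bochner_Integration.integral_diff Bochner_Integration.integral_sum)
qed

section \<open>From \<open>grad\<close> and \<open>divergence\<close> to derivatives and
  \<open>drift_div\<close>\<close>

lemma GDERIV_imp_grad: "GDERIV f y :> D \<Longrightarrow> grad f y = D"
  unfolding grad_def
proof (rule the_equality)
  fix D' assume "GDERIV f y :> D" "GDERIV f y :> D'"
  then have "(\<lambda>v. v \<bullet> D') = (\<lambda>v. v \<bullet> D)"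
    unfolding gderiv_def by (rule has_derivative_unique[rotated])
  then show "D' = D"
    by (metis vector_eq_ldot)
qed

text \<open>The vector representing the derivative is its adjoint applied to 1; this supplies the
  existence that the definite description in \<open>grad\<close> presupposes.\<close>

lemma differentiable_imp_GDERIV_grad:
  assumes "f differentiable (at y)"
  shows "GDERIV f y :> grad f y"
proof -
  obtain f' where f': "(f has_derivative f') (at y)"
    using assms by (auto simp: differentiable_def)
  have "f' = (\<lambda>v. v \<bullet> adjoint f' 1)"
    using adjoint_works[OF has_derivative_linear[OF f'], of _ 1] by auto
  then have "GDERIV f y :> adjoint f' 1"
    using f' unfolding gderiv_def by metis
  then show ?thesis
    using GDERIV_imp_grad by metis
qed

text \<open>Product rule with gradient -(y/2)\<rho> of the weight. It brings the diffusion term of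
  the equation into the form in which \<open>gauss_integration_by_parts\<close> is stated.\<close>

lemma divergence_weighted:
  assumes "(V has_derivative (\<lambda>v. A *v v)) (at y)"
  shows "1 / gauss_weight y * divergence (\<lambda>x. gauss_weight x *\<^sub>R V x) y = drift_div y (V y) A"
proof -
  define F where "F v = gauss_weight y *\<^sub>R (A *v v) + (- (1/2) * (y \<bullet> v) * gauss_weight y) *\<^sub>R V y" for v
  have "((\<lambda>x. gauss_weight x *\<^sub>R V x) has_derivative F) (at y)"
    unfolding F_def by (rule has_derivative_scaleR[OF has_derivative_gauss_weight assms])
  then have "divergence (\<lambda>x. gauss_weight x *\<^sub>R V x) y = trace (matrix F)"
    unfolding divergence_def jacobian_def by (simp add: frechet_derivative_at[symmetric])
  also have "\<dots> = (\<Sum>i\<in>UNIV. gauss_weight y * A $ i $ i - 1/2 * gauss_weight y * (y $ i * V y $ i))"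
    by (simp add: trace_def matrix_def F_def inner_axis matrix_vector_mult_basis column_def mult_ac)
  also have "\<dots> = gauss_weight y * drift_div y (V y) A"
    by (simp only: drift_div_def trace_def inner_vec_def inner_real_def sum_subtractf sum_distrib_left[symmetric])
       (simp add: algebra_simps)
  finally show ?thesis
    using gauss_weight_pos[of y] by simp
qed

section \<open>The rescaled nonlinearity\<close>

text \<open>Writing the derivative as |z|^(q-2) z gives one formula for both signs. At 0 it
  evaluates to 0, and the difference quotient is bounded there by |z|^(q-1), which tends to
  0.\<close>

lemma has_real_derivative_abs_powr:
  assumes "q > 1"
  shows "((\<lambda>z. \<bar>z\<bar> powr q) has_real_derivative q * \<bar>z\<bar> powr (q - 2) * z) (at z)"
proof -
  consider "z > 0" | "z < 0" | "z = 0" by linarith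
  then show ?thesis
  proof cases
    case 1
    have "((\<lambda>z. z powr q) has_real_derivative q * z powr (q - 1)) (at z)"
      using 1 by (rule has_real_derivative_powr)
    moreover have "z powr (q - 1) = z powr (q - 2) * z"
      using 1 by (simp add: powr_diff power2_eq_square)
    ultimately have "((\<lambda>z. z powr q) has_real_derivative q * \<bar>z\<bar> powr (q - 2) * z) (at z)"
      using 1 by (simp add: mult.assoc)
    then show ?thesis
      by (rule has_field_derivative_transform_within_open[where S = "{0<..}"]) (use 1 in auto)
  next
    case 2
    have "((\<lambda>z. (- z) powr q) has_real_derivative - (q * (- z) powr (q - 1))) (at z)"
      using 2 by (auto intro!: derivative_eq_intros has_real_derivative_powr)
    moreover have "(- z) powr (q - 1) = (- z) powr (q - 2) * (- z)"
      using 2 by (simp add: powr_diff power2_eq_square)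
    ultimately have "((\<lambda>z. (- z) powr q) has_real_derivative q * \<bar>z\<bar> powr (q - 2) * z) (at z)"
      using 2 by (simp add: mult.assoc)
    then show ?thesis
      by (rule has_field_derivative_transform_within_open[where S = "{..<0}"]) (use 2 in auto)
  next
    case 3
    have "((\<lambda>z::real. \<bar>z\<bar> powr (q - 1)) \<longlongrightarrow> \<bar>0\<bar> powr (q - 1)) (at 0)"
      using assms by (intro tendsto_powr' tendsto_intros) auto
    then have "((\<lambda>z::real. \<bar>z\<bar> powr (q - 1)) \<longlongrightarrow> 0) (at 0)"
      by simp
    then have "((\<lambda>z::real. \<bar>z\<bar> powr q / z) \<longlongrightarrow> 0) (at 0)"
    proof (rule Lim_null_comparison[rotated])
      show "\<forall>\<^sub>F z in at (0::real). norm (\<bar>z\<bar> powr q / z) \<le> \<bar>z\<bar> powr (q - 1)"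
        by (auto intro!: always_eventually simp: powr_diff abs_divide)
    qed
    then show ?thesis
      using 3 by (simp add: has_field_derivative_iff)
  qed
qed

lemma continuous_on_abs_powr [continuous_intros]:
  fixes f :: "'b::topological_space \<Rightarrow> real"
  assumes "continuous_on X f" "q > 0"
  shows "continuous_on X (\<lambda>x. \<bar>f x\<bar> powr q)"
  using assms by (intro continuous_on_powr' continuous_intros) auto

text \<open>Above the crossing point of x^r and \<epsilon> x^q the higher power wins; below it x^r
  is bounded by its value there. This trades lower powers of |w| for a small multiple of |w|^(p+1)
  and a constant.\<close>

lemma powr_absorption:
  fixes q r \<epsilon> :: real
  assumes "0 \<le> r" "r < q" "\<epsilon> > 0"
  shows "\<exists>R\<ge>0. \<forall>x\<ge>0. x powr r \<le> \<epsilon> * x powr q + R"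
proof (intro exI conjI allI impI)
  \<comment> \<open>\<open>b\<close> solves b^r = \<epsilon> b^q.\<close>
  define b where "b = (1 / \<epsilon>) powr (1 / (q - r))"
  show "b powr r \<ge> 0" by simp
  fix x :: real assume x: "x \<ge> 0"
  show "x powr r \<le> \<epsilon> * x powr q + b powr r"
  proof (cases "x \<le> b")
    case True
    then have "x powr r \<le> b powr r" using x assms by (intro powr_mono2) auto
    moreover have "\<epsilon> * x powr q \<ge> 0" using assms by simp
    ultimately show ?thesis by linarith
  next
    case False
    have "b > 0" using assms by (simp add: b_def)
    have "1 / \<epsilon> = b powr (q - r)" using assms by (simp add: b_def powr_powr)
    also have "\<dots> \<le> x powr (q - r)" using False \<open>b > 0\<close> assms by (intro powr_mono2) auto
    finally have "1 \<le> \<epsilon> * x powr (q - r)" using assms by (simp add: field_simps)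
    then have "x powr r * 1 \<le> x powr r * (\<epsilon> * x powr (q - r))"
      by (intro mult_left_mono) auto
    also have "\<dots> = \<epsilon> * x powr q"
      by (simp add: powr_add[symmetric])
    finally show ?thesis using powr_ge_zero[of b r] by linarith
  qed
qed

lemma has_real_derivative_primitive:
  assumes "continuous_on UNIV h"
  shows "(primitive h has_real_derivative h z) (at z)"
proof -
  \<comment> \<open>With this choice both 0 and z are interior to [-b, b], so the derivative within
    the interval is two-sided.\<close>
  define b where "b = \<bar>z\<bar> + 1"
  have "((\<lambda>u. LBINT y=ereal 0..u. h y) has_vector_derivative h z) (at z within {-b..b})"
    by (rule interval_integral_FTC2) (use assms in \<open>auto simp: b_def intro: continuous_on_subset\<close>)
  moreover have "at z within {-b..b} = at z"
    by (rule at_within_interior) (auto simp: b_def)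
  ultimately show ?thesis
    by (simp add: has_real_derivative_iff_has_vector_derivative primitive_def[abs_def] zero_ereal_def)
qed

lemma primitive_0 [simp]: "primitive h 0 = 0"
  by (simp add: primitive_def zero_ereal_def)

section \<open>The perturbation and its potential in similarity variables\<close>

definition scaled_h :: "real \<Rightarrow> (real \<Rightarrow> real) \<Rightarrow> real \<Rightarrow> real \<Rightarrow> real" where
  "scaled_h p h s z = exp (- (p * s / (p - 1))) * h (exp (s / (p - 1)) * z)"

text \<open>The prefactor times exp(s/(p-1)) is the prefactor of \<open>scaled_h\<close>, so for
  fixed s this is the primitive in z of \<open>scaled_h\<close> that vanishes at 0.\<close>

definition scaled_H :: "real \<Rightarrow> (real \<Rightarrow> real) \<Rightarrow> real \<Rightarrow> real \<Rightarrow> real" where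
  "scaled_H p h s z = exp (- ((p + 1) / (p - 1) * s)) * primitive h (exp (s / (p - 1)) * z)"

lemma continuous_on_scaled_h [continuous_intros]:
  assumes "continuous_on UNIV h" "continuous_on X f" "continuous_on X g" "p > 1"
  shows "continuous_on X (\<lambda>x. scaled_h p h (f x) (g x))"
  unfolding scaled_h_def using assms
  by (intro continuous_intros continuous_on_compose2[OF assms(1)]) auto

lemma continuous_on_scaled_H [continuous_intros]:
  assumes "continuous_on UNIV h" "continuous_on X f" "continuous_on X g" "p > 1"
  shows "continuous_on X (\<lambda>x. scaled_H p h (f x) (g x))"
proof -
  have "continuous_on UNIV (primitive h)"
    using has_real_derivative_primitive[OF assms(1)] by (meson DERIV_isCont continuous_at_imp_continuous_on)
  then show ?thesis
    unfolding scaled_H_def using assms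
    by (intro continuous_intros continuous_on_compose2[where f = "\<lambda>x. exp (f x / (p - 1)) * g x" and g = "primitive h"]) auto
qed

text \<open>Besides the expected \<open>scaled_h\<close> times \<open>f'\<close>, two terms arise
  from the explicit time dependence, one from the inner and one from the outer exponential. They
  become \<open>remainder\<close>.\<close>

lemma has_real_derivative_scaled_H:
  assumes "continuous_on UNIV h" "p > 1" and f: "(f has_real_derivative f') (at s within X)"
  shows "((\<lambda>s. scaled_H p h s (f s)) has_real_derivative
      scaled_h p h s (f s) * (f' + f s / (p - 1)) - (p + 1) / (p - 1) * scaled_H p h s (f s)) (at s within X)"
proof -
  define E where "E = exp (s / (p - 1))"
  define P where "P = exp (- ((p + 1) / (p - 1) * s))"
  have PE: "P * E = exp (- (p * s / (p - 1)))"
    unfolding P_def E_def exp_add[symmetric] by (simp add: add_divide_distrib algebra_simps)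
  have "((\<lambda>s. exp (s / (p - 1)) * f s) has_real_derivative E * (f' + f s / (p - 1))) (at s within X)"
    using DERIV_mult'[OF DERIV_chain2[OF DERIV_exp DERIV_cdivide[OF DERIV_ident]] f, of "p - 1"]
    by (simp add: E_def algebra_simps)
  from DERIV_chain2[OF has_real_derivative_primitive[OF assms(1)] this]
  have 1: "((\<lambda>s. primitive h (exp (s / (p - 1)) * f s)) has_real_derivative
      h (E * f s) * (E * (f' + f s / (p - 1)))) (at s within X)"
    by (simp add: E_def)
  have 2: "((\<lambda>s. exp (- ((p + 1) / (p - 1) * s))) has_real_derivative P * (- ((p + 1) / (p - 1)))) (at s within X)"
    using assms(2) by (auto intro!: derivative_eq_intros simp: P_def)
  have "((\<lambda>s. scaled_H p h s (f s)) has_real_derivative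
      P * (h (E * f s) * (E * (f' + f s / (p - 1)))) + P * (- ((p + 1) / (p - 1))) * primitive h (E * f s)) (at s within X)"
    unfolding scaled_H_def using DERIV_mult'[OF 2 1] by (simp add: P_def E_def)
  moreover have "P * (h (E * f s) * (E * (f' + f s / (p - 1)))) + P * (- ((p + 1) / (p - 1))) * primitive h (E * f s)
      = (P * E) * h (E * f s) * (f' + f s / (p - 1)) - (p + 1) / (p - 1) * (P * primitive h (E * f s))"
    by (simp add: mult_ac)
  ultimately show ?thesis
    unfolding PE by (simp add: scaled_h_def scaled_H_def E_def P_def)
qed

text \<open>The mean value inequality between 0, where the potential vanishes, and z; the symmetric
  interval treats both signs at once. A bound on h alone thus controls H.\<close>

lemma scaled_H_bound:
  assumes cont: "continuous_on UNIV h" and "p > 1"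
    and b: "\<And>z. \<bar>scaled_h p h s z\<bar> \<le> c * (\<bar>z\<bar> powr p + 1)"
  shows "\<bar>scaled_H p h s z\<bar> \<le> c * (\<bar>z\<bar> powr (p + 1) + \<bar>z\<bar>)"
proof -
  have c: "c \<ge> 0" using b[of 0] assms(2) by simp
  have d: "(scaled_H p h s has_real_derivative scaled_h p h s \<xi>) (at \<xi>)" for \<xi>
  proof -
    define E where "E = exp (s / (p - 1))"
    have PE: "exp (- ((p + 1) / (p - 1) * s)) * E = exp (- (p * s / (p - 1)))"
      unfolding E_def exp_add[symmetric] by (simp add: add_divide_distrib algebra_simps)
    have "((\<lambda>\<xi>. primitive h (E * \<xi>)) has_real_derivative h (E * \<xi>) * E) (at \<xi>)"
      by (rule DERIV_chain2[OF has_real_derivative_primitive[OF cont]]) (auto intro!: derivative_eq_intros)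
    from DERIV_cmult[OF this, of "exp (- ((p + 1) / (p - 1) * s))"] show ?thesis
      unfolding scaled_H_def[abs_def] scaled_h_def E_def[symmetric] PE[symmetric] by (simp add: mult_ac)
  qed
  have "norm (scaled_H p h s z - scaled_H p h s 0) \<le> c * (\<bar>z\<bar> powr p + 1) * norm (z - 0)"
  proof (rule field_differentiable_bound[of "{-\<bar>z\<bar>..\<bar>z\<bar>}"])
    show "norm (scaled_h p h s \<xi>) \<le> c * (\<bar>z\<bar> powr p + 1)" if "\<xi> \<in> {-\<bar>z\<bar>..\<bar>z\<bar>}" for \<xi>
    proof -
      have "\<bar>\<xi>\<bar> powr p \<le> \<bar>z\<bar> powr p" using that assms(2) by (intro powr_mono2) auto
      then have "c * (\<bar>\<xi>\<bar> powr p + 1) \<le> c * (\<bar>z\<bar> powr p + 1)" using c by (intro mult_left_mono) auto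
      then show ?thesis using b[of \<xi>] by simp
    qed
  qed (auto intro: has_field_derivative_at_within d)
  moreover have "\<bar>z\<bar> powr p * \<bar>z\<bar> = \<bar>z\<bar> powr (p + 1)"
    by (cases "z = 0") (auto simp: powr_add)
  ultimately show ?thesis
    by (simp add: scaled_H_def algebra_simps)
qed

section \<open>The energy identity on a time slab\<close>

text \<open>\<open>u'\<close>, \<open>g\<close> and \<open>A\<close> stand for \<open>\<partial>\<^sub>s u\<close>, \<open>\<nabla>u\<close> and \<open>\<nabla>\<^sup>2u\<close>; the time derivatives are one-sided at \<open>t\<close> and \<open>S\<close>.\<close>

locale slab_solution =
  fixes t S p B :: real and h :: "real \<Rightarrow> real"
    and u u' :: "real^'n::finite \<Rightarrow> real \<Rightarrow> real"
    and g :: "real^'n \<Rightarrow> real \<Rightarrow> real^'n" and A :: "real^'n \<Rightarrow> real \<Rightarrow> real^'n^'n"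
  assumes p: "p > 1" and cont_h: "continuous_on UNIV h"
    and u': "\<And>y s. s \<in> {t..S} \<Longrightarrow> (u y has_real_derivative u' y s) (at s within {t..S})"
    and g: "\<And>y s. s \<in> {t..S} \<Longrightarrow> GDERIV (\<lambda>y. u y s) y :> g y s"
    and A: "\<And>y s. s \<in> {t..S} \<Longrightarrow> ((\<lambda>y. g y s) has_derivative (\<lambda>v. A y s *v v)) (at y)"
    and cont_u: "continuous_on (UNIV \<times> {t..S}) (\<lambda>(y, s). u y s)"
    and cont_u': "continuous_on (UNIV \<times> {t..S}) (\<lambda>(y, s). u' y s)"
    and cont_g: "continuous_on (UNIV \<times> {t..S}) (\<lambda>(y, s). g y s)"
    and cont_A: "continuous_on (UNIV \<times> {t..S}) (\<lambda>(y, s). A y s)"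
    and bound_u: "\<And>y s. s \<in> {t..S} \<Longrightarrow> \<bar>u y s\<bar> \<le> B"
    and bound_u': "\<And>y s. s \<in> {t..S} \<Longrightarrow> \<bar>u' y s\<bar> \<le> B"
    and bound_g: "\<And>y s. s \<in> {t..S} \<Longrightarrow> norm (g y s) \<le> B"
    and bound_A: "\<And>y s. s \<in> {t..S} \<Longrightarrow> norm (A y s) \<le> B"
    and equation: "\<And>y s. s \<in> {t..S} \<Longrightarrow> u' y s = drift_div y (g y s) (A y s) - u y s / (p - 1)
        + \<bar>u y s\<bar> powr (p - 1) * u y s + scaled_h p h s (u y s)"
begin

section \<open>Continuity, growth and integrability on a slab\<close>

lemma cont_space:
  assumes "s \<in> {t..S}"
  shows "continuous_on UNIV (\<lambda>y. u y s)" "continuous_on UNIV (\<lambda>y. u' y s)"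
    "continuous_on UNIV (\<lambda>y. g y s)" "continuous_on UNIV (\<lambda>y. A y s)"
proof -
  have *: "continuous_on UNIV (\<lambda>y. F y s)" if "continuous_on (UNIV \<times> {t..S}) (\<lambda>(y, s). F y s)"
    for F :: "real^'n \<Rightarrow> real \<Rightarrow> 'c::topological_space"
  proof -
    have "continuous_on UNIV (\<lambda>y. (\<lambda>(y, s). F y s) (y, s))"
      by (rule continuous_on_compose2[OF that]) (use assms in \<open>auto intro!: continuous_intros\<close>)
    then show ?thesis by simp
  qed
  show "continuous_on UNIV (\<lambda>y. u y s)" "continuous_on UNIV (\<lambda>y. u' y s)"
    "continuous_on UNIV (\<lambda>y. g y s)" "continuous_on UNIV (\<lambda>y. A y s)"
    by (rule *[OF cont_u] *[OF cont_u'] *[OF cont_g] *[OF cont_A])+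
qed

lemma cont_time:
  "continuous_on {t..S} (\<lambda>s. u' y s)"
  "continuous_on {t..S} (\<lambda>s. g y s)" "continuous_on {t..S} (\<lambda>s. A y s)"
proof -
  have *: "continuous_on {t..S} (\<lambda>s. F y s)" if "continuous_on (UNIV \<times> {t..S}) (\<lambda>(y, s). F y s)"
    for F :: "real^'n \<Rightarrow> real \<Rightarrow> 'c::topological_space"
  proof -
    have "continuous_on {t..S} (\<lambda>s. (\<lambda>(y, s). F y s) (y, s))"
      by (rule continuous_on_compose2[OF that]) (auto intro!: continuous_intros)
    then show ?thesis by simp
  qed
  show "continuous_on {t..S} (\<lambda>s. u' y s)"
    "continuous_on {t..S} (\<lambda>s. g y s)" "continuous_on {t..S} (\<lambda>s. A y s)"
    by (rule *[OF cont_u'] *[OF cont_g] *[OF cont_A])+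
qed

lemma cont_drift:
  assumes "s \<in> {t..S}"
  shows "continuous_on UNIV (\<lambda>y. drift_div y (g y s) (A y s))"
    "continuous_on {t..S} (\<lambda>s. drift_div y (g y s) (A y s))"
  unfolding drift_div_def trace_def
  by (intro continuous_intros cont_space[OF assms] cont_time)+

text \<open>The trace of \<open>A\<close> is bounded; linear growth enters only through the product
  of y with the gradient.\<close>

lemma bound_drift:
  assumes "s \<in> {t..S}"
  shows "\<bar>drift_div y (g y s) (A y s)\<bar> \<le> (real CARD('n) + 1) * B * (1 + norm y)"
proof -
  have B: "B \<ge> 0" using bound_u[OF assms, of 0] by linarith
  have tr: "\<bar>trace (A y s)\<bar> \<le> (\<Sum>i\<in>(UNIV::'n set). B)"
    unfolding trace_def
  proof (rule order_trans[OF sum_abs sum_mono])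
    show "\<bar>A y s $ i $ i\<bar> \<le> B" for i
      using Finite_Cartesian_Product.norm_nth_le[of "A y s" i] component_le_norm_cart[of "A y s $ i" i]
        bound_A[OF assms, of y] by linarith
  qed
  have "\<bar>y \<bullet> g y s\<bar> \<le> norm y * B"
    using Cauchy_Schwarz_ineq2[of y "g y s"] mult_left_mono[OF bound_g[OF assms, of y] norm_ge_zero[of y]]
    by linarith
  moreover have "norm y * B \<ge> 0" "real CARD('n) * (B * norm y) \<ge> 0" using B by auto
  moreover have "(real CARD('n) + 1) * B * (1 + norm y)
      = real CARD('n) * B + B + real CARD('n) * (B * norm y) + norm y * B"
    by (simp add: algebra_simps)
  moreover have "\<bar>trace (A y s)\<bar> \<le> real CARD('n) * B"
    using tr by simp
  ultimately show ?thesis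
    using B unfolding drift_div_def by linarith
qed

text \<open>Since \<open>u\<close> takes values in the compact interval [-B, B], any continuous
  \<psi> is bounded along it; no growth condition on \<psi> is involved.\<close>

lemma integrable_weighted:
  assumes "s \<in> {t..S}" and \<psi>: "continuous_on UNIV \<psi>"
  shows "integrable lborel (\<lambda>y. \<psi> (u y s) * gauss_weight y)"
    "integrable lborel (\<lambda>y. \<psi> (u y s) * u' y s * gauss_weight y)"
proof -
  have "compact (\<psi> ` {-B..B})"
    using \<psi> by (intro compact_continuous_image continuous_on_subset[OF \<psi>]) auto
  then obtain K where K: "\<And>z. z \<in> {-B..B} \<Longrightarrow> \<bar>\<psi> z\<bar> \<le> K"
    by (metis bounded_real compact_imp_bounded imageI)
  have bd: "\<bar>\<psi> (u y s)\<bar> \<le> K" for y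
    using K[of "u y s"] bound_u[OF assms(1), of y] by (auto simp: abs_le_iff)
  have cont: "continuous_on UNIV (\<lambda>y. \<psi> (u y s))"
    by (intro continuous_on_compose2[OF \<psi>] cont_space assms) auto
  show "integrable lborel (\<lambda>y. \<psi> (u y s) * gauss_weight y)"
    by (rule integrable_gauss_weight_boundedI[OF borel_measurable_continuous_onI[OF cont] bd])
  show "integrable lborel (\<lambda>y. \<psi> (u y s) * u' y s * gauss_weight y)"
  proof (rule integrable_gauss_weight_boundedI)
    show "\<bar>\<psi> (u y s) * u' y s\<bar> \<le> K * B" for y
      unfolding abs_mult using bd[of y] bound_u'[OF assms(1), of y] by (intro mult_mono) auto
  qed (intro borel_measurable_continuous_onI continuous_intros cont cont_space assms)
qed

lemma integrable_grad:
  assumes "s \<in> {t..S}" "s' \<in> {t..S}"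
  shows "integrable lborel (\<lambda>y. (g y s \<bullet> g y s') * gauss_weight y)"
proof (rule integrable_gauss_weight_boundedI)
  show "\<bar>g y s \<bullet> g y s'\<bar> \<le> B * B" for y
    using Cauchy_Schwarz_ineq2[of "g y s" "g y s'"]
      mult_mono[OF bound_g[OF assms(1), of y] bound_g[OF assms(2), of y]]
      order_trans[OF norm_ge_zero bound_g[OF assms(1), of y]]
    by auto
qed (intro borel_measurable_continuous_onI continuous_intros cont_space assms)

lemma integrable_drift:
  assumes "s \<in> {t..S}" and "continuous_on UNIV f" "\<And>y. \<bar>f y\<bar> \<le> K"
  shows "integrable lborel (\<lambda>y. f y * drift_div y (g y s) (A y s) * gauss_weight y)"
proof (rule integrable_gauss_weightI)
  show "\<bar>f y * drift_div y (g y s) (A y s)\<bar> \<le> (K * ((real CARD('n) + 1) * B)) * (1 + norm y)" for y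
    using mult_mono[OF assms(3)[of y] bound_drift[OF assms(1), of y]] assms(3)[of y]
    by (simp add: abs_mult mult.assoc)
qed (intro borel_measurable_continuous_onI continuous_intros assms cont_drift(1))

text \<open>No derivative of \<open>g\<close> in time is available; instead \<open>|g(s)|\<^sup>2 - |g(s\<^sub>0)|\<^sup>2 = (g(s) - g(s\<^sub>0)) \<bullet> (g(s) + g(s\<^sub>0))\<close>
  is integrated by parts in space before the difference quotient is formed.\<close>

lemma has_real_derivative_gradient_energy:
  assumes s0: "s\<^sub>0 \<in> {t..S}"
  shows "((\<lambda>s. \<integral>y. (norm (g y s))\<^sup>2 * gauss_weight y \<partial>lborel) has_real_derivative
     (\<integral>y. - 2 * u' y s\<^sub>0 * drift_div y (g y s\<^sub>0) (A y s\<^sub>0) * gauss_weight y \<partial>lborel)) (at s\<^sub>0 within {t..S})"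
proof -
  define L where "L y s = drift_div y (g y s) (A y s)" for y s
  \<comment> \<open>For s different from \<open>s\<^sub>0\<close> the integral of \<open>Q s\<close>
    is the difference quotient of the gradient energy. The only quotient left is that of
    \<open>u\<close>, which the bound on \<open>u'\<close> controls.\<close>
  define Q where "Q s y = - ((u y s - u y s\<^sub>0) / (s - s\<^sub>0)) * (L y s + L y s\<^sub>0) * gauss_weight y" for s y
  have diff: "(\<integral>y. (norm (g y s))\<^sup>2 * gauss_weight y \<partial>lborel) - (\<integral>y. (norm (g y s\<^sub>0))\<^sup>2 * gauss_weight y \<partial>lborel)
      = (\<integral>y. - (u y s - u y s\<^sub>0) * (L y s + L y s\<^sub>0) * gauss_weight y \<partial>lborel)" if s: "s \<in> {t..S}" for s
  proof -
    have "(\<integral>y. (norm (g y s))\<^sup>2 * gauss_weight y \<partial>lborel) - (\<integral>y. (norm (g y s\<^sub>0))\<^sup>2 * gauss_weight y \<partial>lborel)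
      = (\<integral>y. (norm (g y s))\<^sup>2 * gauss_weight y - (norm (g y s\<^sub>0))\<^sup>2 * gauss_weight y \<partial>lborel)"
      unfolding power2_norm_eq_inner
      by (rule Bochner_Integration.integral_diff[symmetric]) (intro integrable_grad s s0)+
    also have "\<dots> = (\<integral>y. ((g y s - g y s\<^sub>0) \<bullet> (g y s + g y s\<^sub>0)) * gauss_weight y \<partial>lborel)"
      by (simp add: power2_norm_eq_inner inner_add_right inner_diff_left inner_commute algebra_simps)
    also have "\<dots> = - (\<integral>y. (u y s - u y s\<^sub>0) * drift_div y (g y s + g y s\<^sub>0) (A y s + A y s\<^sub>0) * gauss_weight y \<partial>lborel)"
    proof -
      have "(\<integral>y. (u y s - u y s\<^sub>0) * drift_div y (g y s + g y s\<^sub>0) (A y s + A y s\<^sub>0) * gauss_weight y \<partial>lborel)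
        = - (\<integral>y. ((g y s - g y s\<^sub>0) \<bullet> (g y s + g y s\<^sub>0)) * gauss_weight y \<partial>lborel)"
      proof (rule gauss_integration_by_parts[where B = "2 * B"])
        show "GDERIV (\<lambda>y. u y s - u y s\<^sub>0) y :> g y s - g y s\<^sub>0" for y
          by (rule GDERIV_diff[OF g[OF s] g[OF s0]])
        show "((\<lambda>y. g y s + g y s\<^sub>0) has_derivative (*v) (A y s + A y s\<^sub>0)) (at y)" for y
        proof -
          have "(*v) (A y s + A y s\<^sub>0) = (\<lambda>v. A y s *v v + A y s\<^sub>0 *v v)"
            by (simp add: fun_eq_iff matrix_vector_mult_add_rdistrib)
          then show ?thesis using has_derivative_add[OF A[OF s] A[OF s0]] by simp
        qed
        show "continuous_on UNIV (\<lambda>y. g y s - g y s\<^sub>0)" "continuous_on UNIV (\<lambda>y. A y s + A y s\<^sub>0)"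
          by (intro continuous_intros cont_space s s0)+
        show "\<bar>u y s - u y s\<^sub>0\<bar> \<le> 2 * B" for y
          using bound_u[OF s, of y] bound_u[OF s0, of y] by linarith
        show "norm (g y s - g y s\<^sub>0) \<le> 2 * B" "norm (g y s + g y s\<^sub>0) \<le> 2 * B" for y
          using norm_triangle_ineq4[of "g y s" "g y s\<^sub>0"] norm_triangle_ineq[of "g y s" "g y s\<^sub>0"]
            bound_g[OF s, of y] bound_g[OF s0, of y] by linarith+
        show "norm (A y s + A y s\<^sub>0) \<le> 2 * B" for y
          using norm_triangle_ineq[of "A y s" "A y s\<^sub>0"] bound_A[OF s, of y] bound_A[OF s0, of y] by linarith
      qed
      then show ?thesis by simp
    qed
    also have "\<dots> = (\<integral>y. - (u y s - u y s\<^sub>0) * (L y s + L y s\<^sub>0) * gauss_weight y \<partial>lborel)"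
      by (simp add: L_def drift_div_add del: minus_diff_eq flip: integral_minus)
    finally show ?thesis .
  qed
  define K where "K = (real CARD('n) + 1) * B"
  have "((\<lambda>s. \<integral>y. Q s y \<partial>lborel) \<longlongrightarrow> (\<integral>y. - u' y s\<^sub>0 * (L y s\<^sub>0 + L y s\<^sub>0) * gauss_weight y \<partial>lborel)) (at s\<^sub>0 within {t..S})"
  proof (rule dominated_convergence_within)
    show "integrable lborel (\<lambda>y::real^'n. (B * (2 * K)) * (1 + norm y) * gauss_weight y)"
      by (rule integrable_linear_growth_gauss_weight)
    show "Q s \<in> borel_measurable lborel" if "s \<in> {t..S}" for s
      unfolding Q_def L_def divide_inverse
      by (intro borel_measurable_lborel_continuousI continuous_intros cont_space cont_drift that s0)
    show "(\<lambda>y. - u' y s\<^sub>0 * (L y s\<^sub>0 + L y s\<^sub>0) * gauss_weight y) \<in> borel_measurable lborel"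
      unfolding L_def
      by (intro borel_measurable_lborel_continuousI continuous_intros cont_space cont_drift s0)
    show "((\<lambda>s. Q s y) \<longlongrightarrow> - u' y s\<^sub>0 * (L y s\<^sub>0 + L y s\<^sub>0) * gauss_weight y) (at s\<^sub>0 within {t..S})" for y
      unfolding Q_def
    proof (intro tendsto_intros)
      show "((\<lambda>s. (u y s - u y s\<^sub>0) / (s - s\<^sub>0)) \<longlongrightarrow> u' y s\<^sub>0) (at s\<^sub>0 within {t..S})"
        using u'[OF s0] unfolding has_field_derivative_iff .
      show "((\<lambda>s. L y s) \<longlongrightarrow> L y s\<^sub>0) (at s\<^sub>0 within {t..S})"
        unfolding L_def using cont_drift(2)[OF s0, of y] s0 by (simp add: continuous_on_def)
    qed
    show "\<bar>Q s y\<bar> \<le> (B * (2 * K)) * (1 + norm y) * gauss_weight y" if s: "s \<in> {t..S}" "s \<noteq> s\<^sub>0" for s y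
    proof -
      have "norm (u y s - u y s\<^sub>0) \<le> B * norm (s - s\<^sub>0)"
        using u' bound_u' s s0 by (intro field_differentiable_bound[of "{t..S}" "u y" "u' y"]) auto
      then have 1: "\<bar>(u y s - u y s\<^sub>0) / (s - s\<^sub>0)\<bar> \<le> B"
        using s by (simp add: abs_divide divide_le_eq)
      have 2: "\<bar>L y s + L y s\<^sub>0\<bar> \<le> 2 * K * (1 + norm y)"
        using bound_drift[OF s(1), of y] bound_drift[OF s0, of y] unfolding L_def K_def by linarith
      have "\<bar>Q s y\<bar> = \<bar>(u y s - u y s\<^sub>0) / (s - s\<^sub>0)\<bar> * \<bar>L y s + L y s\<^sub>0\<bar> * gauss_weight y"
        using gauss_weight_pos[of y] by (simp add: Q_def abs_mult)
      also have "\<dots> \<le> B * (2 * K * (1 + norm y)) * gauss_weight y"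
        using 1 2 gauss_weight_pos[of y] bound_u[OF s0, of y] by (intro mult_right_mono mult_mono) auto
      finally show ?thesis by (simp add: mult_ac)
    qed
  qed
  moreover have "\<forall>\<^sub>F s in at s\<^sub>0 within {t..S}. (\<integral>y. Q s y \<partial>lborel)
      = ((\<integral>y. (norm (g y s))\<^sup>2 * gauss_weight y \<partial>lborel) - (\<integral>y. (norm (g y s\<^sub>0))\<^sup>2 * gauss_weight y \<partial>lborel)) / (s - s\<^sub>0)"
    unfolding eventually_at_filter
  proof (intro always_eventually allI impI)
    fix s assume "s \<noteq> s\<^sub>0" "s \<in> {t..S}"
    have "Q s y = - (u y s - u y s\<^sub>0) * (L y s + L y s\<^sub>0) * gauss_weight y / (s - s\<^sub>0)" for y
      by (simp add: Q_def del: minus_diff_eq)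
    then show "(\<integral>y. Q s y \<partial>lborel)
      = ((\<integral>y. (norm (g y s))\<^sup>2 * gauss_weight y \<partial>lborel) - (\<integral>y. (norm (g y s\<^sub>0))\<^sup>2 * gauss_weight y \<partial>lborel)) / (s - s\<^sub>0)"
      unfolding diff[OF \<open>s \<in> {t..S}\<close>] by (simp only: integral_divide_zero)
  qed
  ultimately have "((\<lambda>s. ((\<integral>y. (norm (g y s))\<^sup>2 * gauss_weight y \<partial>lborel)
        - (\<integral>y. (norm (g y s\<^sub>0))\<^sup>2 * gauss_weight y \<partial>lborel)) / (s - s\<^sub>0))
      \<longlongrightarrow> (\<integral>y. - u' y s\<^sub>0 * (L y s\<^sub>0 + L y s\<^sub>0) * gauss_weight y \<partial>lborel)) (at s\<^sub>0 within {t..S})"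
    by (rule Lim_transform_eventually)
  then show ?thesis
    unfolding has_field_derivative_iff L_def by (simp add: algebra_simps)
qed

section \<open>Energy, dissipation and the virial identity\<close>

definition \<Phi> :: "real \<Rightarrow> real \<Rightarrow> real" where
  "\<Phi> s z = 1 / (2 * (p - 1)) * z\<^sup>2 - 1 / (p + 1) * \<bar>z\<bar> powr (p + 1) - scaled_H p h s z"

text \<open>The gradient term is kept apart from the pointwise density \<Phi>: the latter is
  differentiated under the integral, the former only after integrating by parts.\<close>

definition energy_at :: "real \<Rightarrow> real" where
  "energy_at s = 1/2 * (\<integral>y. (norm (g y s))\<^sup>2 * gauss_weight y \<partial>lborel)
     + (\<integral>y. \<Phi> s (u y s) * gauss_weight y \<partial>lborel)"

definition dissipation :: "real \<Rightarrow> real" where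
  "dissipation s = (\<integral>y. (u' y s)\<^sup>2 * gauss_weight y \<partial>lborel)"

text \<open>This is the derivative of \<Phi> in s at fixed z, that is, minus the explicit time
  derivative of \<open>scaled_H\<close>.\<close>

definition remainder :: "real \<Rightarrow> real \<Rightarrow> real" where
  "remainder s z = (p + 1) / (p - 1) * scaled_H p h s z - 1 / (p - 1) * (scaled_h p h s z * z)"

lemma continuous_on_\<Phi>: "continuous_on UNIV (\<Phi> s)"
  unfolding \<Phi>_def[abs_def] using p by (intro continuous_intros cont_h) auto

lemma continuous_on_remainder: "continuous_on UNIV (remainder s)"
  unfolding remainder_def[abs_def] using p by (intro continuous_intros cont_h) auto

lemma integrable_dissipation:
  assumes "s \<in> {t..S}"
  shows "integrable lborel (\<lambda>y. (u' y s)\<^sup>2 * gauss_weight y)"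
proof (rule integrable_gauss_weight_boundedI)
  show "\<bar>(u' y s)\<^sup>2\<bar> \<le> B\<^sup>2" for y
    using power_mono[OF bound_u'[OF assms, of y], of 2] by simp
qed (intro borel_measurable_continuous_onI continuous_intros cont_space assms)

lemma weighted_linear:
  assumes s: "s \<in> {t..S}" and "continuous_on UNIV \<psi>" "continuous_on UNIV \<eta>"
  shows "(\<integral>y. (\<psi> (u y s) + \<eta> (u y s)) * gauss_weight y \<partial>lborel)
     = (\<integral>y. \<psi> (u y s) * gauss_weight y \<partial>lborel) + (\<integral>y. \<eta> (u y s) * gauss_weight y \<partial>lborel)"
    "(\<integral>y. (c * \<psi> (u y s)) * gauss_weight y \<partial>lborel) = c * (\<integral>y. \<psi> (u y s) * gauss_weight y \<partial>lborel)"
  by (simp_all add: distrib_right integrable_weighted[OF s] assms mult.assoc)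

lemma weighted_mono:
  assumes s: "s \<in> {t..S}" and "continuous_on UNIV \<psi>" "continuous_on UNIV \<eta>" and "\<And>z. \<psi> z \<le> \<eta> z"
  shows "(\<integral>y. \<psi> (u y s) * gauss_weight y \<partial>lborel) \<le> (\<integral>y. \<eta> (u y s) * gauss_weight y \<partial>lborel)"
  using assms by (intro integral_mono integrable_weighted[OF s] mult_right_mono less_imp_le[OF gauss_weight_pos])

text \<open>With L the drift term, the gradient part contributes -u' L and the density contributes
  \<phi> u' plus the remainder. The equation says \<phi> = L - u', so the terms in L cancel and
  -u'^2 is left.\<close>

lemma has_real_derivative_energy_at:
  assumes s0: "s\<^sub>0 \<in> {t..S}"
  shows "(energy_at has_real_derivative
     - dissipation s\<^sub>0 + (\<integral>y. remainder s\<^sub>0 (u y s\<^sub>0) * gauss_weight y \<partial>lborel)) (at s\<^sub>0 within {t..S})"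
proof -
  \<comment> \<open>\<phi> is the derivative of \<Phi> in z.\<close>
  define \<phi> where "\<phi> s z = 1 / (p - 1) * z - \<bar>z\<bar> powr (p - 1) * z - scaled_h p h s z" for s z
  have cont2: "continuous_on X (\<lambda>x. \<phi> (f x) (k x))" "continuous_on X (\<lambda>x. remainder (f x) (k x))"
    if "continuous_on X f" "continuous_on X k" for X :: "'z::topological_space set" and f k
    unfolding \<phi>_def remainder_def using p that by (intro continuous_intros cont_h; simp)+
  \<comment> \<open>Compactness in (s, z) jointly yields one constant for all times of the slab, as
    the majorant must not depend on s. Pairing the two functions gives both bounds at once.\<close>
  have "compact ((\<lambda>x. (\<phi> (fst x) (snd x), remainder (fst x) (snd x))) ` ({t..S} \<times> {-B..B}))"
    by (intro compact_continuous_image compact_Times cont2 continuous_intros) auto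
  then obtain K where K: "\<And>x. x \<in> {t..S} \<times> {-B..B} \<Longrightarrow> norm (\<phi> (fst x) (snd x), remainder (fst x) (snd x)) \<le> K"
    by (metis (no_types, lifting) bounded_iff compact_imp_bounded imageI)
  have Kb: "\<bar>\<phi> s (u y s)\<bar> \<le> K" "\<bar>remainder s (u y s)\<bar> \<le> K" if "s \<in> {t..S}" for s y
    using K[of "(s, u y s)"] bound_u[OF that, of y] that
      norm_fst_le[of "\<phi> s (u y s)" "remainder s (u y s)"] norm_snd_le[of "remainder s (u y s)" "\<phi> s (u y s)"]
    by (auto simp: abs_le_iff)
  define f' where "f' s y = (\<phi> s (u y s) * u' y s + remainder s (u y s)) * gauss_weight y" for s y
  have d\<Phi>: "((\<lambda>s. \<integral>y. \<Phi> s (u y s) * gauss_weight y \<partial>lborel) has_real_derivative (\<integral>y. f' s\<^sub>0 y \<partial>lborel))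
      (at s\<^sub>0 within {t..S})"
  proof (rule has_real_derivative_integral[OF _ s0])
    show "integrable lborel (\<lambda>y. \<Phi> s (u y s) * gauss_weight y)" if "s \<in> {t..S}" for s
      by (rule integrable_weighted(1)[OF that continuous_on_\<Phi>])
    show "f' s\<^sub>0 \<in> borel_measurable lborel"
      unfolding f'_def
      by (intro borel_measurable_lborel_continuousI continuous_intros cont_space s0 cont2)
    show "((\<lambda>s. \<Phi> s (u y s) * gauss_weight y) has_real_derivative f' s y) (at s within {t..S})"
      if s: "s \<in> {t..S}" for s y
    proof -
      have 1: "((\<lambda>s. \<bar>u y s\<bar> powr (p + 1)) has_real_derivative
          (p + 1) * \<bar>u y s\<bar> powr (p + 1 - 2) * u y s * u' y s) (at s within {t..S})"
        using p by (intro DERIV_chain2[OF has_real_derivative_abs_powr u'[OF s]]) auto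
      have 2: "((\<lambda>s. (u y s)\<^sup>2) has_real_derivative 2 * u y s * u' y s) (at s within {t..S})"
        by (auto intro!: derivative_eq_intros u'[OF s])
      have "((\<lambda>s. \<Phi> s (u y s) * gauss_weight y) has_real_derivative
         (1 / (2 * (p - 1)) * (2 * u y s * u' y s)
          - 1 / (p + 1) * ((p + 1) * \<bar>u y s\<bar> powr (p + 1 - 2) * u y s * u' y s)
          - (scaled_h p h s (u y s) * (u' y s + u y s / (p - 1)) - (p + 1) / (p - 1) * scaled_H p h s (u y s)))
         * gauss_weight y) (at s within {t..S})"
        unfolding \<Phi>_def
        by (intro DERIV_cmult_right DERIV_diff DERIV_cmult 1 2 has_real_derivative_scaled_H cont_h p u'[OF s])
      moreover have "(1 / (2 * (p - 1)) * (2 * u y s * u' y s)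
          - 1 / (p + 1) * ((p + 1) * \<bar>u y s\<bar> powr (p + 1 - 2) * u y s * u' y s)
          - (scaled_h p h s (u y s) * (u' y s + u y s / (p - 1)) - (p + 1) / (p - 1) * scaled_H p h s (u y s)))
         = \<phi> s (u y s) * u' y s + remainder s (u y s)"
      proof -
        have "1 / (2 * (p - 1)) * (2 * u y s * u' y s) = u y s * u' y s / (p - 1)"
          using mult_divide_mult_cancel_left[of 2 "u y s * u' y s" "p - 1"]
          by (simp add: right_diff_distrib mult.assoc)
        moreover have "1 / (p + 1) * ((p + 1) * \<bar>u y s\<bar> powr (p + 1 - 2) * u y s * u' y s)
            = \<bar>u y s\<bar> powr (p - 1) * u y s * u' y s"
          using p by simp
        ultimately show ?thesis
          by (simp add: \<phi>_def remainder_def algebra_simps)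
      qed
      ultimately show ?thesis unfolding f'_def by simp
    qed
    show "integrable lborel (\<lambda>y::real^'n. (K * B + K) * gauss_weight y)"
      by (rule integrable_gauss_weight_boundedI[where C = "\<bar>K * B + K\<bar>"]) auto
    show "\<bar>f' s y\<bar> \<le> (K * B + K) * gauss_weight y" if s: "s \<in> {t..S}" for s y
    proof -
      have "\<bar>\<phi> s (u y s) * u' y s\<bar> \<le> K * B"
        unfolding abs_mult using Kb(1)[OF s, of y] bound_u'[OF s, of y] by (intro mult_mono) auto
      then have "\<bar>\<phi> s (u y s) * u' y s + remainder s (u y s)\<bar> \<le> K * B + K"
        using Kb(2)[OF s, of y] by linarith
      then show ?thesis
        unfolding f'_def abs_mult using gauss_weight_pos[of y] by (simp add: mult_right_mono)
    qed
  qed simp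
  have "(energy_at has_real_derivative
      1/2 * (\<integral>y. - 2 * u' y s\<^sub>0 * drift_div y (g y s\<^sub>0) (A y s\<^sub>0) * gauss_weight y \<partial>lborel)
      + (\<integral>y. f' s\<^sub>0 y \<partial>lborel)) (at s\<^sub>0 within {t..S})"
    unfolding energy_at_def[abs_def]
    by (intro DERIV_add DERIV_cmult has_real_derivative_gradient_energy s0 d\<Phi>)
  moreover have "1/2 * (\<integral>y. - 2 * u' y s\<^sub>0 * drift_div y (g y s\<^sub>0) (A y s\<^sub>0) * gauss_weight y \<partial>lborel)
      + (\<integral>y. f' s\<^sub>0 y \<partial>lborel) = - dissipation s\<^sub>0 + (\<integral>y. remainder s\<^sub>0 (u y s\<^sub>0) * gauss_weight y \<partial>lborel)"
  proof -
    define L where "L y = drift_div y (g y s\<^sub>0) (A y s\<^sub>0)" for y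
    have eq: "\<phi> s\<^sub>0 (u y s\<^sub>0) = L y - u' y s\<^sub>0" for y
      using equation[OF s0, of y] by (simp add: \<phi>_def L_def)
    have i1: "integrable lborel (\<lambda>y. u' y s\<^sub>0 * L y * gauss_weight y)"
      unfolding L_def by (rule integrable_drift[OF s0 cont_space(2)[OF s0] bound_u'[OF s0]])
    have i2: "integrable lborel (\<lambda>y. remainder s\<^sub>0 (u y s\<^sub>0) * gauss_weight y)"
      by (rule integrable_weighted(1)[OF s0 continuous_on_remainder])
    have "f' s\<^sub>0 y = u' y s\<^sub>0 * L y * gauss_weight y - (u' y s\<^sub>0)\<^sup>2 * gauss_weight y
        + remainder s\<^sub>0 (u y s\<^sub>0) * gauss_weight y" for y
      unfolding f'_def eq by (simp add: power2_eq_square algebra_simps)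
    then have "(\<integral>y. f' s\<^sub>0 y \<partial>lborel) = (\<integral>y. u' y s\<^sub>0 * L y * gauss_weight y \<partial>lborel) - dissipation s\<^sub>0
        + (\<integral>y. remainder s\<^sub>0 (u y s\<^sub>0) * gauss_weight y \<partial>lborel)"
      by (simp add: i1 i2 integrable_dissipation[OF s0] dissipation_def)
    moreover have "(\<integral>y. - 2 * u' y s\<^sub>0 * L y * gauss_weight y \<partial>lborel)
        = - 2 * (\<integral>y. u' y s\<^sub>0 * L y * gauss_weight y \<partial>lborel)"
      by (simp only: mult.assoc integral_mult_right_zero)
    ultimately show ?thesis by (simp add: L_def)
  qed
  ultimately show ?thesis by simp
qed

text \<open>Testing with \<open>u\<close> produces minus the gradient integral, which is completed
  to -2 \<open>energy_at\<close>. The coefficient of the power term is then 1 - 2/(p+1) =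
  (p-1)/(p+1).\<close>

lemma virial_identity:
  assumes s: "s \<in> {t..S}"
  shows "(\<integral>y. u y s * u' y s * gauss_weight y \<partial>lborel)
    = - 2 * energy_at s + (p - 1) / (p + 1) * (\<integral>y. \<bar>u y s\<bar> powr (p + 1) * gauss_weight y \<partial>lborel)
      + (\<integral>y. (scaled_h p h s (u y s) * u y s - 2 * scaled_H p h s (u y s)) * gauss_weight y \<partial>lborel)"
proof -
  define \<psi> where "\<psi> z = scaled_h p h s z * z - 2 * scaled_H p h s z" for z
  have c\<psi>: "continuous_on UNIV \<psi>"
    unfolding \<psi>_def[abs_def] by (intro continuous_intros cont_h p)
  have cpow: "continuous_on UNIV (\<lambda>z::real. \<bar>z\<bar> powr (p + 1))"
    using p by (intro continuous_intros) auto
  \<comment> \<open>This is z times the terms of the equation without derivatives of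
    \<open>u\<close>, written so that -2 \<Phi> is visible.\<close>
  define \<eta> where "\<eta> z = - 2 * \<Phi> s z + ((p - 1) / (p + 1) * \<bar>z\<bar> powr (p + 1) + \<psi> z)" for z
  have c\<eta>: "continuous_on UNIV \<eta>"
    unfolding \<eta>_def[abs_def] by (intro continuous_intros c\<psi> continuous_on_\<Phi> cpow)
  have *: "u y s * u' y s = u y s * drift_div y (g y s) (A y s) + \<eta> (u y s)" for y
  proof -
    have "\<bar>u y s\<bar> powr (p + 1) = \<bar>u y s\<bar> powr (p - 1) * \<bar>u y s\<bar> powr 2"
      unfolding powr_add[symmetric] by (rule arg_cong[where f = "(powr) \<bar>u y s\<bar>"]) simp
    also have "\<bar>u y s\<bar> powr 2 = u y s * u y s"
      by (simp add: powr_numeral power2_eq_square)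
    finally have 1: "\<bar>u y s\<bar> powr (p + 1) = \<bar>u y s\<bar> powr (p - 1) * (u y s * u y s)" .
    have "(p - 1) / (p + 1) + 2 / (p + 1) = 1"
      using p by (simp add: add_divide_distrib[symmetric])
    then have 2: "(p - 1) / (p + 1) * c + 2 / (p + 1) * c = c" for c :: real
      by (metis distrib_right mult_1)
    have "\<eta> (u y s) = - (u y s * u y s / (p - 1)) + \<bar>u y s\<bar> powr (p + 1) + scaled_h p h s (u y s) * u y s"
      using 2[of "\<bar>u y s\<bar> powr (p + 1)"] mult_divide_mult_cancel_left[of 2 "u y s * u y s" "p - 1"]
      by (simp add: \<eta>_def \<Phi>_def \<psi>_def power2_eq_square right_diff_distrib)
    then show ?thesis
      unfolding equation[OF s, of y] 1 by (simp add: algebra_simps)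
  qed
  have "(\<integral>y. u y s * u' y s * gauss_weight y \<partial>lborel)
      = (\<integral>y. u y s * drift_div y (g y s) (A y s) * gauss_weight y \<partial>lborel)
        + (\<integral>y. \<eta> (u y s) * gauss_weight y \<partial>lborel)"
    unfolding * distrib_right
    by (rule Bochner_Integration.integral_add[OF integrable_drift[OF s cont_space(1)[OF s] bound_u[OF s]]
          integrable_weighted(1)[OF s c\<eta>]])
  also have "(\<integral>y. u y s * drift_div y (g y s) (A y s) * gauss_weight y \<partial>lborel)
      = - (\<integral>y. (norm (g y s))\<^sup>2 * gauss_weight y \<partial>lborel)"
    unfolding power2_norm_eq_inner
    by (rule gauss_integration_by_parts[OF g[OF s] A[OF s] cont_space(3,4)[OF s]
          bound_u[OF s] bound_g[OF s] bound_g[OF s] bound_A[OF s]])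
  also have "(\<integral>y. \<eta> (u y s) * gauss_weight y \<partial>lborel)
     = - 2 * (\<integral>y. \<Phi> s (u y s) * gauss_weight y \<partial>lborel)
       + ((p - 1) / (p + 1) * (\<integral>y. \<bar>u y s\<bar> powr (p + 1) * gauss_weight y \<partial>lborel)
       + (\<integral>y. \<psi> (u y s) * gauss_weight y \<partial>lborel))"
  proof -
    have c1: "continuous_on UNIV (\<lambda>z. - 2 * \<Phi> s z)"
      and c2: "continuous_on UNIV (\<lambda>z. (p - 1) / (p + 1) * \<bar>z\<bar> powr (p + 1))"
      by (intro continuous_intros continuous_on_\<Phi> cpow)+
    show ?thesis
      unfolding \<eta>_def weighted_linear(1)[OF s c1 continuous_on_add[OF c2 c\<psi>]]
        weighted_linear(1)[OF s c2 c\<psi>] weighted_linear(2)[OF s continuous_on_\<Phi> continuous_on_\<Phi>]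
        weighted_linear(2)[OF s cpow cpow] ..
  qed
  finally show ?thesis
    by (simp add: energy_at_def \<psi>_def)
qed

text \<open>Continuity makes the time integral of the dissipation differentiable in its upper limit,
  and lets its two notions of integral be identified at the end.\<close>

lemma continuous_on_dissipation: "continuous_on {t..S} dissipation"
  unfolding continuous_on_def dissipation_def
proof
  fix s\<^sub>0 assume s0: "s\<^sub>0 \<in> {t..S}"
  show "((\<lambda>s. \<integral>y. (u' y s)\<^sup>2 * gauss_weight y \<partial>lborel) \<longlongrightarrow>
      (\<integral>y. (u' y s\<^sub>0)\<^sup>2 * gauss_weight y \<partial>lborel)) (at s\<^sub>0 within {t..S})"
  proof (rule dominated_convergence_within)
    show "integrable lborel (\<lambda>y::real^'n. B\<^sup>2 * gauss_weight y)"
      by (rule integrable_gauss_weight_boundedI[where C = "B\<^sup>2"]) auto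
    show "((\<lambda>s. (u' y s)\<^sup>2 * gauss_weight y) \<longlongrightarrow> (u' y s\<^sub>0)\<^sup>2 * gauss_weight y) (at s\<^sub>0 within {t..S})" for y
      using cont_time(1)[of y] s0 by (intro tendsto_intros) (simp add: continuous_on_def)
    show "\<bar>(u' y s)\<^sup>2 * gauss_weight y\<bar> \<le> B\<^sup>2 * gauss_weight y" if "s \<in> {t..S}" for s y
      using power_mono[OF bound_u'[OF that, of y], of 2] gauss_weight_pos[of y]
      by (simp add: abs_mult mult_right_mono)
  qed (use integrable_dissipation s0 in \<open>auto dest: borel_measurable_integrable\<close>)
qed

section \<open>The Lyapunov inequality\<close>

text \<open>Here \<open>k\<close> stands for \<open>C\<^sub>0\<close> s^(-a). Four times
  \<open>k\<close> ((p+1)/(p-1))^2 times the virial bound is played against the remainder. The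
  condition \<open>6 * k \<le> \<eta>\<close> absorbs the perturbation in the virial identity; the
  one with 8 leaves half of the dissipation.\<close>

lemma energy_dissipation_inequality:
  assumes s: "s \<in> {t..S}"
    and k: "k \<ge> 0" "6 * k \<le> \<eta>" "8 * ((p + 1) / (p - 1))\<^sup>2 * k \<le> 1" and \<eta>: "\<eta> = (p - 1) / (8 * (p + 1))"
    and bound_h: "\<And>z. \<bar>scaled_h p h s z\<bar> \<le> k * (\<bar>z\<bar> powr p + 1)"
    and R1: "R\<^sub>1 \<ge> 0" "\<And>x. x \<ge> 0 \<Longrightarrow> x \<le> 1 / (p + 1) * x powr (p + 1) + R\<^sub>1"
    and R2: "\<And>x. x \<ge> 0 \<Longrightarrow> x\<^sup>2 \<le> \<eta> * x powr (p + 1) + R\<^sub>2"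
  shows "- dissipation s + (\<integral>y. remainder s (u y s) * gauss_weight y \<partial>lborel)
      - 8 * ((p + 1) / (p - 1))\<^sup>2 * k * energy_at s
    \<le> - 1/2 * dissipation s + k * (((p + 2) / (p - 1) * R\<^sub>1 + 4 * ((p + 1) / (p - 1))\<^sup>2 * (R\<^sub>2 + \<eta> * R\<^sub>1))
        * (\<integral>y. gauss_weight (y::real^'n) \<partial>lborel))"
proof -
  define m where "m = (\<integral>y. gauss_weight (y::real^'n) \<partial>lborel)"
  define P where "P = (\<integral>y. \<bar>u y s\<bar> powr (p + 1) * gauss_weight y \<partial>lborel)"
  define W where "W = dissipation s"
  define x where "x = (p + 1) / (p - 1)"
  have cpow: "continuous_on UNIV (\<lambda>z::real. \<bar>z\<bar> powr (p + 1))"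
    using p by (intro continuous_intros) auto
  have "W \<ge> 0"
    unfolding W_def dissipation_def by (intro integral_nonneg_AE AE_I2) simp
  have "P \<ge> 0"
    unfolding P_def by (intro integral_nonneg_AE AE_I2) simp
  have R1': "x \<le> 1 * x powr (p + 1) + R\<^sub>1" if "x \<ge> 0" for x
  proof -
    have "1 / (p + 1) * x powr (p + 1) \<le> 1 * x powr (p + 1)"
      using p by (intro mult_right_mono) auto
    then show ?thesis using R1(2)[OF that] by linarith
  qed
  have int_affine: "(\<integral>y. (b * \<bar>u y s\<bar> powr (p + 1) + c) * gauss_weight y \<partial>lborel) = b * P + c * m" for b c
  proof -
    have cb: "continuous_on UNIV (\<lambda>z. b * \<bar>z\<bar> powr (p + 1))"
      by (intro continuous_intros cpow)
    have "(\<integral>y. (b * \<bar>u y s\<bar> powr (p + 1) + c) * gauss_weight y \<partial>lborel)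
      = (\<integral>y. (b * \<bar>u y s\<bar> powr (p + 1)) * gauss_weight y \<partial>lborel) + (\<integral>y. c * gauss_weight (y::real^'n) \<partial>lborel)"
      by (rule weighted_linear(1)[OF s cb continuous_on_const])
    then show ?thesis
      unfolding weighted_linear(2)[OF s cpow cpow] P_def m_def by simp
  qed
  have H: "\<bar>scaled_H p h s z\<bar> \<le> k * (\<bar>z\<bar> powr (p + 1) + \<bar>z\<bar>)" for z
    by (rule scaled_H_bound[OF cont_h p bound_h])
  have hz: "\<bar>scaled_h p h s z * z\<bar> \<le> k * (\<bar>z\<bar> powr (p + 1) + \<bar>z\<bar>)" for z
  proof -
    have "\<bar>z\<bar> powr p * \<bar>z\<bar> = \<bar>z\<bar> powr (p + 1)"
      by (cases "z = 0") (auto simp: powr_add)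
    then show ?thesis
      using mult_right_mono[OF bound_h[of z] abs_ge_zero[of z]] by (simp add: abs_mult algebra_simps)
  qed
  have rem: "(\<integral>y. remainder s (u y s) * gauss_weight y \<partial>lborel)
      \<le> k * (p + 2) / (p - 1) * ((p + 2) / (p + 1)) * P + k * (p + 2) / (p - 1) * R\<^sub>1 * m"
  proof -
    have "remainder s z \<le> k * (p + 2) / (p - 1) * ((p + 2) / (p + 1)) * \<bar>z\<bar> powr (p + 1) + k * (p + 2) / (p - 1) * R\<^sub>1" for z
    proof -
      have "remainder s z \<le> (p + 1) / (p - 1) * (k * (\<bar>z\<bar> powr (p + 1) + \<bar>z\<bar>)) + 1 / (p - 1) * (k * (\<bar>z\<bar> powr (p + 1) + \<bar>z\<bar>))"
      proof -
        have "(p + 1) / (p - 1) * scaled_H p h s z \<le> (p + 1) / (p - 1) * (k * (\<bar>z\<bar> powr (p + 1) + \<bar>z\<bar>))"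
          using H[of z] p by (intro mult_left_mono) auto
        moreover have "1 / (p - 1) * (- (scaled_h p h s z * z)) \<le> 1 / (p - 1) * (k * (\<bar>z\<bar> powr (p + 1) + \<bar>z\<bar>))"
          using hz[of z] p by (intro mult_left_mono) auto
        ultimately show ?thesis unfolding remainder_def by linarith
      qed
      also have "\<dots> = k * (p + 2) / (p - 1) * (\<bar>z\<bar> powr (p + 1) + \<bar>z\<bar>)"
        by (simp add: add_divide_distrib[symmetric] algebra_simps flip: distrib_right)
      also have "\<dots> \<le> k * (p + 2) / (p - 1) * ((p + 2) / (p + 1) * \<bar>z\<bar> powr (p + 1) + R\<^sub>1)"
      proof (rule mult_left_mono)
        have "(p + 2) / (p + 1) = 1 + 1 / (p + 1)" using p by (simp add: field_simps)
        then have "(p + 2) / (p + 1) * \<bar>z\<bar> powr (p + 1) = \<bar>z\<bar> powr (p + 1) + 1 / (p + 1) * \<bar>z\<bar> powr (p + 1)"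
          by (simp add: distrib_right)
        then show "\<bar>z\<bar> powr (p + 1) + \<bar>z\<bar> \<le> (p + 2) / (p + 1) * \<bar>z\<bar> powr (p + 1) + R\<^sub>1"
          using R1(2)[of "\<bar>z\<bar>"] by simp
      qed (use k p in simp)
      finally show ?thesis by (simp only: distrib_left mult.assoc)
    qed
    then show ?thesis
      unfolding int_affine[symmetric]
      by (rule weighted_mono[OF s continuous_on_remainder, rotated]) (intro continuous_intros cpow)
  qed
  have vir: "(p - 1) / (p + 1) * P \<le> 2 * energy_at s + W + (\<eta> * P + R\<^sub>2 * m) + (6 * k * P + 3 * k * R\<^sub>1 * m)"
  proof -
    have "(\<integral>y. u y s * u' y s * gauss_weight y \<partial>lborel)
        \<le> (\<integral>y. (u' y s)\<^sup>2 * gauss_weight y + (\<eta> * \<bar>u y s\<bar> powr (p + 1) + R\<^sub>2) * gauss_weight y \<partial>lborel)"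
    proof (rule integral_mono)
      show "integrable lborel (\<lambda>y. u y s * u' y s * gauss_weight y)"
        by (rule integrable_weighted(2)[OF s continuous_on_id])
      show "integrable lborel (\<lambda>y. (u' y s)\<^sup>2 * gauss_weight y + (\<eta> * \<bar>u y s\<bar> powr (p + 1) + R\<^sub>2) * gauss_weight y)"
        by (intro Bochner_Integration.integrable_add integrable_dissipation s integrable_weighted(1)[OF s]
              continuous_intros cpow)
      fix y
      \<comment> \<open>The square of \<open>u\<close> is subcritical with respect to |u|^(p+1), so
        \<open>R2\<close> absorbs it at the price of one \<eta>.\<close>
      have "u y s * u' y s \<le> (u' y s)\<^sup>2 + (u y s)\<^sup>2"
        using zero_le_power2[of "u y s - u' y s"] zero_le_power2[of "u y s"] zero_le_power2[of "u' y s"]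
        unfolding power2_diff by linarith
      also have "\<dots> \<le> (u' y s)\<^sup>2 + (\<eta> * \<bar>u y s\<bar> powr (p + 1) + R\<^sub>2)"
        using R2[of "\<bar>u y s\<bar>"] by simp
      finally show "u y s * u' y s * gauss_weight y
          \<le> (u' y s)\<^sup>2 * gauss_weight y + (\<eta> * \<bar>u y s\<bar> powr (p + 1) + R\<^sub>2) * gauss_weight y"
        unfolding distrib_right[symmetric] by (rule mult_right_mono) (rule less_imp_le[OF gauss_weight_pos])
    qed
    also have "\<dots> = W + (\<eta> * P + R\<^sub>2 * m)"
      unfolding W_def dissipation_def int_affine[symmetric]
      by (intro Bochner_Integration.integral_add integrable_dissipation s integrable_weighted(1)[OF s]
            continuous_intros cpow)
    finally have a: "(\<integral>y. u y s * u' y s * gauss_weight y \<partial>lborel) \<le> W + (\<eta> * P + R\<^sub>2 * m)" .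
    \<comment> \<open>One \<open>k\<close> from h z and two from 2 H make 3k; replacing |z| by
      |z|^(p+1) + \<open>R\<^sub>1\<close> doubles this, hence the 6 in the smallness
      condition.\<close>
    have low: "- (6 * k) * \<bar>z\<bar> powr (p + 1) + - (3 * k * R\<^sub>1) \<le> scaled_h p h s z * z - 2 * scaled_H p h s z" for z
    proof -
      have "\<bar>z\<bar> powr (p + 1) + \<bar>z\<bar> \<le> 2 * \<bar>z\<bar> powr (p + 1) + R\<^sub>1"
        using R1'[of "\<bar>z\<bar>"] by simp
      from mult_left_mono[OF this, of "3 * k"]
      have "3 * (k * (\<bar>z\<bar> powr (p + 1) + \<bar>z\<bar>)) \<le> 6 * k * \<bar>z\<bar> powr (p + 1) + 3 * k * R\<^sub>1"
        using k by (simp add: algebra_simps)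
      then show ?thesis using H[of z] hz[of z] by linarith
    qed
    have "- (6 * k) * P + - (3 * k * R\<^sub>1) * m
        \<le> (\<integral>y. (scaled_h p h s (u y s) * u y s - 2 * scaled_H p h s (u y s)) * gauss_weight y \<partial>lborel)"
      unfolding int_affine[symmetric]
      by (rule weighted_mono[OF s _ _ low]; intro continuous_intros cpow cont_h p)
    then have b: "- (6 * k * P + 3 * k * R\<^sub>1 * m)
        \<le> (\<integral>y. (scaled_h p h s (u y s) * u y s - 2 * scaled_H p h s (u y s)) * gauss_weight y \<partial>lborel)"
      by simp
    have "X \<le> 2 * E + r + L" if "v \<le> r" "v = - 2 * E + X + I" "- L \<le> I" for X E r L v I :: real
      using that by linarith
    from this[OF a virial_identity[OF s, folded P_def] b] show ?thesis
      by (simp only: add.assoc)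
  qed
  have \<eta>x: "(p - 1) / (p + 1) = 8 * \<eta>" by (simp only: \<eta> times_divide_eq_right mult_divide_mult_cancel_left_if) simp
  have "m \<ge> 0"
    unfolding m_def by (intro integral_nonneg_AE AE_I2) simp
  have "6 * k * P \<le> \<eta> * P" "6 * k * (R\<^sub>1 * m) \<le> \<eta> * (R\<^sub>1 * m)"
    by (rule mult_right_mono[OF k(2)], rule \<open>P \<ge> 0\<close>)
       (rule mult_right_mono[OF k(2)], rule mult_nonneg_nonneg[OF R1(1) \<open>m \<ge> 0\<close>])
  moreover have "0 \<le> 6 * k * (R\<^sub>1 * m)"
    using k \<open>m \<ge> 0\<close> R1 by simp
  \<comment> \<open>Of the coefficient 8 \<eta> of P, one \<eta> goes to the squared
    \<open>u\<close> and one to the perturbation.\<close>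
  ultimately have vir2: "6 * \<eta> * P \<le> 2 * energy_at s + W + (R\<^sub>2 + \<eta> * R\<^sub>1) * m"
    using vir unfolding \<eta>x by (simp add: algebra_simps)
  have "x > 0" using p by (simp add: x_def)
  \<comment> \<open>The factor turns 2 E into the required 8 x^2 k E; since x \<eta> = 1/8, it also
    turns 6 \<eta> P into 3 x k P.\<close>
  from mult_left_mono[OF vir2, of "4 * x\<^sup>2 * k"]
  have 1: "4 * x\<^sup>2 * k * (6 * \<eta> * P) \<le> 8 * x\<^sup>2 * k * energy_at s + 4 * x\<^sup>2 * k * W + k * (4 * x\<^sup>2 * (R\<^sub>2 + \<eta> * R\<^sub>1) * m)"
    using k by (simp add: algebra_simps)
  have "x * \<eta> = 1/8" using p by (simp add: x_def \<eta>)
  then have "4 * x\<^sup>2 * k * (6 * \<eta> * P) = 3 * x * k * P"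
    by (simp add: power2_eq_square mult.assoc mult.left_commute[of _ \<eta>])
  moreover have "k * (p + 2) / (p - 1) * ((p + 2) / (p + 1)) * P \<le> 3 * x * k * P"
  proof -
    \<comment> \<open>this is where the constant \<open>8\<close> in \<open>\<gamma>\<close> is large enough\<close>
    have "(p + 2) * (p + 2) \<le> 3 * (p + 1) * (p + 1)"
    proof -
      have "3 * (p + 1) * (p + 1) - (p + 2) * (p + 2) = 2 * (p * p) + 2 * p - 1"
        by (simp add: algebra_simps)
      moreover have "p * p > 0" using p by simp
      ultimately show ?thesis using p by linarith
    qed
    then have "(p + 2) / (p - 1) * ((p + 2) / (p + 1)) \<le> 3 * x"
      using p by (simp add: x_def divide_simps)
    from mult_right_mono[OF this, of "k * P"] show ?thesis
      using k \<open>P \<ge> 0\<close> by (simp add: mult_ac)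
  qed
  moreover have "4 * x\<^sup>2 * k * W \<le> 1/2 * W"
    using k(3) \<open>W \<ge> 0\<close> by (intro mult_right_mono) (auto simp: x_def)
  ultimately have "- W + (\<integral>y. remainder s (u y s) * gauss_weight y \<partial>lborel) - 8 * x\<^sup>2 * k * energy_at s
    \<le> - 1/2 * W + k * (p + 2) / (p - 1) * R\<^sub>1 * m + k * (4 * x\<^sup>2 * (R\<^sub>2 + \<eta> * R\<^sub>1) * m)"
    using rem 1 by linarith
  also have "\<dots> = - 1/2 * W + k * (((p + 2) / (p - 1) * R\<^sub>1 + 4 * x\<^sup>2 * (R\<^sub>2 + \<eta> * R\<^sub>1)) * m)"
    by (simp add: algebra_simps)
  finally show ?thesis unfolding W_def m_def x_def .
qed

text \<open>Splitting Bochner integrals requires integrability of each part, which the bounds on the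
  slab provide.\<close>

lemma energy_eq_energy_at:
  assumes s: "s \<in> {t..S}"
  shows "energy p h u s = energy_at s"
proof -
  define \<psi> where "\<psi> z = 1 / (2 * (p - 1)) * z\<^sup>2 - 1 / (p + 1) * \<bar>z\<bar> powr (p + 1)" for z
  have c\<psi>: "continuous_on UNIV \<psi>"
    unfolding \<psi>_def[abs_def] using p by (intro continuous_intros) auto
  have cH: "continuous_on UNIV (\<lambda>z. scaled_H p h s z)"
    by (intro continuous_intros cont_h p)
  have grad: "grad (\<lambda>x. u x s) y = g y s" for y
    by (rule GDERIV_imp_grad[OF g[OF s]])
  have "(\<integral>y. (1/2 * (norm (g y s))\<^sup>2 + \<psi> (u y s)) * gauss_weight y \<partial>lborel)
    = 1/2 * (\<integral>y. (norm (g y s))\<^sup>2 * gauss_weight y \<partial>lborel) + (\<integral>y. \<psi> (u y s) * gauss_weight y \<partial>lborel)"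
    using integrable_grad[OF s s] integrable_weighted(1)[OF s c\<psi>]
    by (simp add: distrib_right power2_norm_eq_inner)
  moreover have "(\<integral>y. \<Phi> s (u y s) * gauss_weight y \<partial>lborel)
    = (\<integral>y. \<psi> (u y s) * gauss_weight y \<partial>lborel) - (\<integral>y. scaled_H p h s (u y s) * gauss_weight y \<partial>lborel)"
    unfolding \<Phi>_def \<psi>_def[symmetric] left_diff_distrib
    by (rule Bochner_Integration.integral_diff[OF integrable_weighted(1)[OF s c\<psi>] integrable_weighted(1)[OF s cH]])
  moreover have "(\<integral>y. scaled_H p h s (u y s) * gauss_weight y \<partial>lborel)
    = exp (- ((p + 1) / (p - 1) * s)) * (\<integral>y. primitive h (exp (s / (p - 1)) * u y s) * gauss_weight y \<partial>lborel)"
    by (simp only: scaled_H_def mult.assoc integral_mult_right_zero)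
  ultimately show ?thesis
    unfolding energy_def energy_at_def grad by (simp add: \<psi>_def add_diff_eq)
qed

text \<open>The exponential factor e satisfies e' = -\<gamma> s^(-a) e, so the derivative of the
  product with the energy is e times the left-hand side of \<open>ineq\<close>, whatever the sign of
  the energy. It suffices that J plus half the accumulated dissipation is nonincreasing.\<close>

lemma lyapunov_decay:
  fixes a \<gamma> \<theta> c \<Lambda> :: real
  assumes a: "a > 1" and s12: "0 < s\<^sub>1" "t \<le> s\<^sub>1" "s\<^sub>1 < s\<^sub>2" "s\<^sub>2 \<le> S" and c: "c \<ge> 0"
    and ineq: "\<And>s. s \<in> {s\<^sub>1..s\<^sub>2} \<Longrightarrow>
      - dissipation s + (\<integral>y. remainder s (u y s) * gauss_weight y \<partial>lborel) - \<gamma> * s powr (- a) * energy_at s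
        \<le> - 1/2 * dissipation s + c * s powr (- a)"
    and \<gamma>: "\<And>s. s \<in> {s\<^sub>1..s\<^sub>2} \<Longrightarrow> 0 \<le> \<gamma> / (a - 1) * s powr (1 - a) \<and> \<gamma> / (a - 1) * s powr (1 - a) \<le> \<Lambda>"
    and \<theta>: "\<theta> \<ge> exp \<Lambda> * c / (a - 1)"
  defines "J \<equiv> \<lambda>s. energy_at s * exp (\<gamma> / (a - 1) * s powr (1 - a)) + \<theta> * s powr (1 - a)"
  shows "J s\<^sub>2 - J s\<^sub>1 \<le> - 1/2 * integral {s\<^sub>1..s\<^sub>2} dissipation"
proof -
  define E' where "E' s = - dissipation s + (\<integral>y. remainder s (u y s) * gauss_weight y \<partial>lborel)" for s
  define e where "e s = exp (\<gamma> / (a - 1) * s powr (1 - a))" for s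
  define F where "F s = J s + 1/2 * integral {s\<^sub>1..s} dissipation" for s
  define F' where "F' s = E' s * e s + energy_at s * (e s * (- \<gamma> * s powr (- a)))
      + \<theta> * ((1 - a) * s powr (- a)) + 1/2 * dissipation s" for s
  have dF: "(F has_real_derivative F' s) (at s within {s\<^sub>1..s\<^sub>2})" if s: "s \<in> {s\<^sub>1..s\<^sub>2}" for s
  proof -
    have "s > 0" using s s12 by auto
    have 1: "(energy_at has_real_derivative E' s) (at s within {s\<^sub>1..s\<^sub>2})"
      unfolding E'_def using s s12 by (intro DERIV_subset[OF has_real_derivative_energy_at]) auto
    have 2: "((\<lambda>s. s powr (1 - a)) has_real_derivative (1 - a) * s powr (- a)) (at s within {s\<^sub>1..s\<^sub>2})"
      using has_real_derivative_powr[OF \<open>s > 0\<close>, of "1 - a"] by (auto intro: has_field_derivative_at_within)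
    have 3: "(e has_real_derivative e s * (- \<gamma> * s powr (- a))) (at s within {s\<^sub>1..s\<^sub>2})"
    proof -
      have "(e has_real_derivative e s * (\<gamma> / (a - 1) * ((1 - a) * s powr (- a)))) (at s within {s\<^sub>1..s\<^sub>2})"
        unfolding e_def[abs_def] by (intro DERIV_chain2[OF DERIV_exp] DERIV_cmult 2)
      moreover have "\<gamma> / (a - 1) * ((1 - a) * s powr (- a)) = - \<gamma> * s powr (- a)"
        using a by (simp add: field_simps)
      ultimately show ?thesis by metis
    qed
    have 4: "((\<lambda>s. integral {s\<^sub>1..s} dissipation) has_real_derivative dissipation s) (at s within {s\<^sub>1..s\<^sub>2})"
      using s s12 by (intro integral_has_real_derivative continuous_on_subset[OF continuous_on_dissipation]) auto
    show ?thesis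
      unfolding F_def[abs_def] F'_def J_def e_def[symmetric]
      by (rule DERIV_add[OF DERIV_add[OF DERIV_mult'[OF 1 3, THEN DERIV_cong] DERIV_cmult[OF 2]] DERIV_cmult[OF 4]])
         (simp add: add.commute)
  qed
  have F'_nonpos: "F' s \<le> 0" if s: "s \<in> {s\<^sub>1..s\<^sub>2}" for s
  proof -
    have "W \<ge> 0" if "W = dissipation s" for W
      unfolding that dissipation_def by (intro integral_nonneg_AE AE_I2) simp
    then have W: "dissipation s \<ge> 0" by simp
    have e: "1 \<le> e s" "e s \<le> exp \<Lambda>" using \<gamma>[OF s] by (auto simp: e_def)
    have "F' s = e s * (E' s - \<gamma> * s powr (- a) * energy_at s)
        - \<theta> * (a - 1) * s powr (- a) + 1/2 * dissipation s"
      by (simp add: F'_def algebra_simps)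
    also have "e s * (E' s - \<gamma> * s powr (- a) * energy_at s) \<le> e s * (- 1/2 * dissipation s + c * s powr (- a))"
      using ineq[OF s] e unfolding E'_def by (intro mult_left_mono) auto
    \<comment> \<open>The two terms use opposite bounds on e: at least 1 keeps half of the
      dissipation, at most exp \<Lambda> controls the constant, which fixes the threshold for
      \<theta>.\<close>
    also have "\<dots> \<le> - 1/2 * dissipation s + exp \<Lambda> * c * s powr (- a)"
    proof -
      have "1 * (1/2 * dissipation s) \<le> e s * (1/2 * dissipation s)"
        using e W by (intro mult_right_mono) auto
      moreover have "e s * (c * s powr (- a)) \<le> exp \<Lambda> * (c * s powr (- a))"
        using e c by (intro mult_right_mono) auto
      ultimately show ?thesis by (simp add: algebra_simps)
    qed
    also have "exp \<Lambda> * c * s powr (- a) \<le> \<theta> * (a - 1) * s powr (- a)"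
      using \<theta> a by (intro mult_right_mono) (auto simp: divide_le_eq)
    finally show ?thesis by simp
  qed
  have "F s\<^sub>2 \<le> F s\<^sub>1"
  \<comment> \<open>The derivatives are two-sided only in the interior; at the end points continuity
    suffices.\<close>
  proof (rule DERIV_nonpos_imp_decreasing_open[where f = F])
    show "\<exists>y. (F has_real_derivative y) (at x) \<and> y \<le> 0" if "s\<^sub>1 < x" "x < s\<^sub>2" for x
      using dF[of x] F'_nonpos[of x] that at_within_interior[of x "{s\<^sub>1..s\<^sub>2}"] by auto
    show "continuous_on {s\<^sub>1..s\<^sub>2} F"
      using dF by (rule DERIV_continuous_on)
  qed (use s12 in simp)
  then show ?thesis
    unfolding F_def by simp
qed

end

section \<open>From global solutions to slabs, and the choice of the constants\<close>

lemma slab_solution_of_regular_solution: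
  assumes p: "p > 1" and h: "nonlinearity a p M h"
    and reg: "regular_from t w" and sol: "solution_from t p h w"
  obtains B where "slab_solution t S p B h w (time_deriv t w)
    (\<lambda>y s. grad (\<lambda>x. w x s) y) (\<lambda>y s. hessian (\<lambda>x. w x s) y)"
proof -
  define g where "g y s = grad (\<lambda>x. w x s) y" for y s
  define A where "A y s = hessian (\<lambda>x. w x s) y" for y s
  have bc: "bounded_continuous_on (UNIV \<times> {t..S}) (\<lambda>(y, s). w y s)"
    "bounded_continuous_on (UNIV \<times> {t..S}) (\<lambda>(y, s). time_deriv t w y s)"
    "bounded_continuous_on (UNIV \<times> {t..S}) (\<lambda>(y, s). g y s)"
    "bounded_continuous_on (UNIV \<times> {t..S}) (\<lambda>(y, s). A y s)"
    using reg unfolding regular_from_def g_def A_def by blast+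
  have bd: "\<exists>b. \<forall>y. \<forall>s\<in>{t..S}. norm (F y s) \<le> b"
    if "bounded_continuous_on (UNIV \<times> {t..S}) (\<lambda>(y, s). F y s)"
    for F :: "real^'a \<Rightarrow> real \<Rightarrow> 'c::real_normed_vector"
    using that unfolding bounded_continuous_on_def bounded_iff by fastforce
  obtain b1 b2 b3 b4 where b:
    "\<And>y s. s \<in> {t..S} \<Longrightarrow> norm (w y s) \<le> b1"
    "\<And>y s. s \<in> {t..S} \<Longrightarrow> norm (time_deriv t w y s) \<le> b2"
    "\<And>y s. s \<in> {t..S} \<Longrightarrow> norm (g y s) \<le> b3"
    "\<And>y s. s \<in> {t..S} \<Longrightarrow> norm (A y s) \<le> b4"
    using bd[OF bc(1)] bd[OF bc(2)] bd[OF bc(3)] bd[OF bc(4)] by blast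
  define B where "B = Max {b1, b2, b3, b4}"
  have B: "b1 \<le> B" "b2 \<le> B" "b3 \<le> B" "b4 \<le> B" by (auto simp: B_def)
  have dA: "((\<lambda>y. g y s) has_derivative (\<lambda>v. A y s *v v)) (at y)" if "s \<in> {t..S}" for y s
    using reg that unfolding regular_from_def g_def A_def hessian_def
    by (subst jacobian_works[symmetric]) auto
  have "slab_solution t S p B h w (time_deriv t w) g A"
  proof
    show "continuous_on UNIV h"
      using h unfolding nonlinearity_def
      by (meson continuous_at_imp_continuous_on differentiable_imp_continuous_within)
    show "(w y has_real_derivative time_deriv t w y s) (at s within {t..S})" if "s \<in> {t..S}" for y s
    proof -
      have "w y differentiable (at s within {t..})"
        using reg that unfolding regular_from_def by auto
      \<comment> \<open>\<open>time_deriv\<close> is taken within [t, \<infinity>); passing to the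
        smaller set [t, S] makes it one-sided at S as well.\<close>
      then have "(w y has_real_derivative time_deriv t w y s) (at s within {t..})"
        by (simp add: vector_derivative_works time_deriv_def has_real_derivative_iff_has_vector_derivative)
      then show ?thesis
        by (rule DERIV_subset) auto
    qed
    show "GDERIV (\<lambda>y. w y s) y :> g y s" if "s \<in> {t..S}" for y s
      using reg that unfolding regular_from_def g_def by (intro differentiable_imp_GDERIV_grad) auto
    show "time_deriv t w y s = drift_div y (g y s) (A y s) - w y s / (p - 1)
        + \<bar>w y s\<bar> powr (p - 1) * w y s + scaled_h p h s (w y s)" if "s \<in> {t..S}" for y s
      using sol that unfolding solution_from_def scaled_h_def divergence_weighted[OF dA[OF that], symmetric]
      by (auto simp: g_def)
    show "\<bar>w y s\<bar> \<le> B" "\<bar>time_deriv t w y s\<bar> \<le> B" "norm (g y s) \<le> B" "norm (A y s) \<le> B"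
      if "s \<in> {t..S}" for y s
      using b[OF that, of y] B by auto
  qed (use p bc dA in \<open>auto simp: bounded_continuous_on_def\<close>)
  then show ?thesis
    using that unfolding g_def[abs_def] A_def[abs_def] by blast
qed

theorem theorem1:
  fixes a p M C\<^sub>0 s\<^sub>0 :: real
  assumes "a > 1" and "p > 1" and "M > 0"
    and "(real CARD('n::finite) - 2) * p < real CARD('n) + 2"
    and "scaling_constants a p M C\<^sub>0 s\<^sub>0"
  shows "\<exists>s\<^sub>h \<theta>\<^sub>h :: real. s\<^sub>h \<ge> s\<^sub>0 \<and>
    (\<forall>(h :: real \<Rightarrow> real) (T :: real) (w :: real ^ 'n \<Rightarrow> real \<Rightarrow> real).
       nonlinearity a p M h \<longrightarrow> T > 0 \<longrightarrow>
       regular_from (- ln T) w \<longrightarrow> solution_from (- ln T) p h w \<longrightarrow>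
       (\<forall>\<theta>\<ge>\<theta>\<^sub>h. \<forall>s\<^sub>1 s\<^sub>2. max s\<^sub>h (- ln T) \<le> s\<^sub>1 \<longrightarrow> s\<^sub>1 < s\<^sub>2 \<longrightarrow>
          lyapunov a p C\<^sub>0 \<theta> h w s\<^sub>2 - lyapunov a p C\<^sub>0 \<theta> h w s\<^sub>1
            \<le> - (1 / 2) * (LBINT s=s\<^sub>1..s\<^sub>2.
                 \<integral>y. (time_deriv (- ln T) w y s)\<^sup>2 * gauss_weight y \<partial>lborel)))"
proof -
  have C0: "C\<^sub>0 > 0" and s0: "s\<^sub>0 > 0"
    using assms(5) by (auto simp: scaling_constants_def)
  have scale: "\<bar>scaled_h p h s z\<bar> \<le> C\<^sub>0 / s powr a * (\<bar>z\<bar> powr p + 1)"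
    if "nonlinearity a p M h" "s \<ge> s\<^sub>0" for h s z
  proof -
    have "\<forall>j\<in>{0, 1::nat}. exp (- ((p - real j) * s / (p - 1))) * \<bar>(deriv ^^ j) h (exp (s / (p - 1)) * z)\<bar>
             \<le> C\<^sub>0 / s powr a * (\<bar>z\<bar> powr (p - real j) + 1)"
      using assms(5) that unfolding scaling_constants_def by blast
    from bspec[OF this, of 0] show ?thesis
      by (simp add: scaled_h_def abs_mult)
  qed
  define \<eta> where "\<eta> = (p - 1) / (8 * (p + 1))"
  define x where "x = (p + 1) / (p - 1)"
  \<comment> \<open>\<kappa> encodes both smallness conditions on \<open>k\<close> in
    \<open>energy_dissipation_inequality\<close>.\<close>
  define \<kappa> where "\<kappa> = min (\<eta> / 6) (1 / (8 * x\<^sup>2))"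
  have \<eta>: "\<eta> > 0" and x: "x > 0"
    using assms by (auto simp: \<eta>_def x_def)
  then have \<kappa>: "\<kappa> > 0" by (simp add: \<kappa>_def)
  obtain R\<^sub>1 where R1: "R\<^sub>1 \<ge> 0" "\<And>x. x \<ge> 0 \<Longrightarrow> x \<le> 1 / (p + 1) * x powr (p + 1) + R\<^sub>1"
    using powr_absorption[of 1 "p + 1" "1 / (p + 1)"] assms by auto
  obtain R\<^sub>2 where R2: "R\<^sub>2 \<ge> 0" "\<And>x. x \<ge> 0 \<Longrightarrow> x\<^sup>2 \<le> \<eta> * x powr (p + 1) + R\<^sub>2"
    using powr_absorption[of 2 "p + 1" \<eta>] assms \<eta> by (auto simp: powr_numeral)
  define m where "m = (\<integral>y. gauss_weight (y::real^'n) \<partial>lborel)"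
  have m: "m \<ge> 0"
    unfolding m_def by (intro integral_nonneg_AE AE_I2) simp
  \<comment> \<open>The constant of \<open>energy_dissipation_inequality\<close> with the factor
    s^(-a) of \<open>k\<close> taken out; the dimension enters through the mass
    \<open>m\<close>.\<close>
  define c where "c = C\<^sub>0 * (((p + 2) / (p - 1) * R\<^sub>1 + 4 * x\<^sup>2 * (R\<^sub>2 + \<eta> * R\<^sub>1)) * m)"
  have c: "c \<ge> 0"
    using C0 R1 R2 m \<eta> assms(2) by (simp add: c_def)
  define \<gamma> where "\<gamma> = lyapunov_rate p C\<^sub>0"
  have \<gamma>1: "\<gamma> = 8 * x\<^sup>2 * C\<^sub>0"
    by (simp add: \<gamma>_def lyapunov_rate_def x_def)
  moreover have "8 * x\<^sup>2 * C\<^sub>0 > 0"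
    using C0 x by simp
  ultimately have \<gamma>2: "\<gamma> > 0"
    by simp
  \<comment> \<open>The second entry is the time at which \<open>C\<^sub>0\<close> s^(-a) falls to
    \<kappa>. This time, \<Lambda> and \<open>\<theta>\<^sub>h\<close> are all fixed before h, T and
    w.\<close>
  define s\<^sub>h where "s\<^sub>h = max s\<^sub>0 ((C\<^sub>0 / \<kappa>) powr (1 / a))"
  define \<Lambda> where "\<Lambda> = \<gamma> / (a - 1) * s\<^sub>h powr (1 - a)"
  define \<theta>\<^sub>h where "\<theta>\<^sub>h = exp \<Lambda> * c / (a - 1)"
  have sh: "s\<^sub>h > 0" "s\<^sub>h \<ge> s\<^sub>0" using s0 by (auto simp: s\<^sub>h_def)
  have small: "C\<^sub>0 / s powr a \<le> \<kappa>" if "s \<ge> s\<^sub>h" for s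
  proof -
    have "C\<^sub>0 / \<kappa> = ((C\<^sub>0 / \<kappa>) powr (1 / a)) powr a"
      using C0 \<kappa> assms(1) by (simp add: powr_powr)
    also have "\<dots> \<le> s powr a"
      using that assms(1) by (intro powr_mono2) (auto simp: s\<^sub>h_def)
    finally show ?thesis
      using \<kappa> that sh by (simp add: field_simps)
  qed
  show ?thesis
  proof (rule exI[of _ s\<^sub>h], rule exI[of _ \<theta>\<^sub>h], intro conjI sh allI impI)
    fix h T and w :: "real^'n \<Rightarrow> real \<Rightarrow> real" and \<theta> s\<^sub>1 s\<^sub>2 :: real
    assume h: "nonlinearity a p M h" and T: "T > 0" and reg: "regular_from (- ln T) w"
      and sol: "solution_from (- ln T) p h w" and \<theta>: "\<theta> \<ge> \<theta>\<^sub>h"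
      and s1: "max s\<^sub>h (- ln T) \<le> s\<^sub>1" and s12: "s\<^sub>1 < s\<^sub>2"
    \<comment> \<open>The slab may end at \<open>s\<^sub>2\<close>, so \<open>B\<close> depends on
      the solution and on \<open>s\<^sub>2\<close>; the constants above do not involve it.\<close>
    obtain B where "slab_solution (- ln T) s\<^sub>2 p B h w (time_deriv (- ln T) w)
      (\<lambda>y s. grad (\<lambda>x. w x s) y) (\<lambda>y s. hessian (\<lambda>x. w x s) y)"
      using slab_solution_of_regular_solution[OF assms(2) h reg sol] .
    then interpret slab_solution "- ln T" s\<^sub>2 p B h w "time_deriv (- ln T) w"
      "\<lambda>y s. grad (\<lambda>x. w x s) y" "\<lambda>y s. hessian (\<lambda>x. w x s) y" .
    have in_slab: "s \<in> {- ln T..s\<^sub>2}" "s \<ge> s\<^sub>h" "s > 0" if "s \<in> {s\<^sub>1..s\<^sub>2}" for s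
      using that s1 sh by auto
    have lyap: "lyapunov a p C\<^sub>0 \<theta> h w s = energy_at s * exp (\<gamma> / (a - 1) * s powr (1 - a)) + \<theta> * s powr (1 - a)"
      if "s \<in> {s\<^sub>1..s\<^sub>2}" for s
      unfolding lyapunov_def \<gamma>_def energy_eq_energy_at[OF in_slab(1)[OF that]] ..
    have "lyapunov a p C\<^sub>0 \<theta> h w s\<^sub>2 - lyapunov a p C\<^sub>0 \<theta> h w s\<^sub>1 \<le> - 1/2 * integral {s\<^sub>1..s\<^sub>2} dissipation"
      unfolding lyap[of s\<^sub>1, OF atLeastAtMost_iff[THEN iffD2, OF conjI[OF order_refl less_imp_le[OF s12]]]]
        lyap[of s\<^sub>2, OF atLeastAtMost_iff[THEN iffD2, OF conjI[OF less_imp_le[OF s12] order_refl]]]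
    proof (rule lyapunov_decay)
      show "\<theta> \<ge> exp \<Lambda> * c / (a - 1)" using \<theta> by (simp add: \<theta>\<^sub>h_def)
      fix s assume s: "s \<in> {s\<^sub>1..s\<^sub>2}"
      show "0 \<le> \<gamma> / (a - 1) * s powr (1 - a) \<and> \<gamma> / (a - 1) * s powr (1 - a) \<le> \<Lambda>"
      proof
        have "s powr (1 - a) \<le> s\<^sub>h powr (1 - a)"
          using in_slab[OF s] sh assms(1) by (intro powr_mono2') auto
        then show "\<gamma> / (a - 1) * s powr (1 - a) \<le> \<Lambda>"
          unfolding \<Lambda>_def using \<gamma>2 assms(1) by (intro mult_left_mono) auto
      qed (use \<gamma>2 assms(1) in simp)
      define k where "k = C\<^sub>0 / s powr a"
      \<comment> \<open>With this \<open>k\<close>, 8 x^2 k is exactly \<gamma> s^(-a).\<close>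
      have k: "k = C\<^sub>0 * s powr (- a)" by (simp add: k_def powr_minus_divide)
      have "k \<le> \<kappa>" unfolding k_def by (rule small[OF in_slab(2)[OF s]])
      then have "6 * k \<le> \<eta>" "8 * x\<^sup>2 * k \<le> 1"
        using x by (auto simp: \<kappa>_def field_simps)
      moreover have "\<bar>scaled_h p h s z\<bar> \<le> k * (\<bar>z\<bar> powr p + 1)" for z
        unfolding k_def by (rule scale[OF h]) (use in_slab[OF s] sh in linarith)
      ultimately have "- dissipation s + (\<integral>y. remainder s (w y s) * gauss_weight y \<partial>lborel) - 8 * x\<^sup>2 * k * energy_at s
        \<le> - 1/2 * dissipation s + k * (((p + 2) / (p - 1) * R\<^sub>1 + 4 * x\<^sup>2 * (R\<^sub>2 + \<eta> * R\<^sub>1)) * m)"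
        unfolding x_def m_def using C0 in_slab[OF s]
        by (intro energy_dissipation_inequality[where \<eta> = \<eta>] \<eta>_def R1 R2) (auto simp: k_def)
      then show "- dissipation s + (\<integral>y. remainder s (w y s) * gauss_weight y \<partial>lborel) - \<gamma> * s powr (- a) * energy_at s
        \<le> - 1/2 * dissipation s + c * s powr (- a)"
        unfolding k \<gamma>1 c_def by (simp add: mult_ac)
    qed (use assms(1) c in_slab[of s\<^sub>1] s12 s1 in auto)
    \<comment> \<open>The decay estimate is stated with the gauge integral and the theorem with the
      oriented Lebesgue integral; for a continuous integrand and ordered limits they agree.\<close>
    also have "integral {s\<^sub>1..s\<^sub>2} dissipation = (LBINT s=s\<^sub>1..s\<^sub>2. dissipation s)"
      using s12 s1
      by (intro interval_integral_eq_integral[symmetric] borel_integrable_atLeastAtMost'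
            continuous_on_subset[OF continuous_on_dissipation]) auto
    finally show "lyapunov a p C\<^sub>0 \<theta> h w s\<^sub>2 - lyapunov a p C\<^sub>0 \<theta> h w s\<^sub>1
            \<le> - (1 / 2) * (LBINT s=s\<^sub>1..s\<^sub>2.
                 \<integral>y. (time_deriv (- ln T) w y s)\<^sup>2 * gauss_weight y \<partial>lborel)"
      by (simp add: dissipation_def)
  qed
qed

end
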